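(* Let $R$ be a reduced ring. If either $J(R)\neq 0$ or $|R|>2^{2^{\aleph_0}}$, then $R$ is submaximal. Moreover, in this case every ring $T$ containing $R$ as a subring is submaximal too.
   Context: All rings are commutative with $1\neq 0$, and a subring of a ring contains the identity of that ring. A maximal subring of $R$ is a proper subring $S\subsetneq R$ such that there is no subring strictly between $S$ and $R$; $R$ is called submaximal if it has at least one maximal subring. $J(R)$ is the Jacobson radical of $R$. *)

theory Defs
  imports "HOL-Algebra.Algebra" "HOL-Library.Equipollence"
begin

locale nonzero_cring = cring +
  assumes one_not_zero: "\<one> \<noteq> \<zero>"

definition reduced_ring :: "('a, 'm) ring_scheme \<Rightarrow> bool" where
  "reduced_ring R \<longleftrightarrow>
     (\<forall>x \<in> carrier R. \<forall>n::nat. x [^]\<^bsub>R\<^esub> n = \<zero>\<^bsub>R\<^esub> \<longrightarrow> x = \<zero>\<^bsub>R\<^esub>)"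

(* The intersection with the carrier matters only when there are no maximal ideals,
   i.e. for the zero ring, where the bare intersection would be UNIV. *)
definition jacobson_radical :: "('a, 'm) ring_scheme \<Rightarrow> 'a set" where
  "jacobson_radical R = carrier R \<inter> \<Inter>{M. maximalideal M R}"

definition maximal_subring :: "'a set \<Rightarrow> ('a, 'm) ring_scheme \<Rightarrow> bool" where
  "maximal_subring S R \<longleftrightarrow>
     subring S R \<and> S \<subset> carrier R \<and>
     \<not> (\<exists>S'. subring S' R \<and> S \<subset> S' \<and> S' \<subset> carrier R)"

definition submaximal :: "('a, 'm) ring_scheme \<Rightarrow> bool" where
  "submaximal R \<longleftrightarrow> (\<exists>S. maximal_subring S R)"

end

theory Submission
  imports Defs
begin

text \<open>
  Let \<open>u\<close> be a unit of a domain \<open>D\<close> and \<open>S\<close> a subring containing \<open>u\<close> but not \<open>1/u\<close>, such that every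
  element of \<open>D\<close> is moved into \<open>S\<close> by a power of \<open>u\<close>.  Then a subring that contains \<open>S\<close> and is maximal
  among those avoiding \<open>1/u\<close> is a maximal subring of \<open>D\<close>.  Such an \<open>S\<close> is the trace on \<open>D\<close> of a rank
  one valuation ring; it exists as soon as \<open>u\<close> is transcendental over the prime subring, or is a
  prime number in characteristic 0.  Instead of passing to fraction fields, one extends a base
  subring in which \<open>u\<close> is a separated prime element by transcendental elements (Gauss's lemma) until
  \<open>D\<close> is algebraic over it, and then takes a subring maximal among those in which no element of the
  base becomes newly divisible by \<open>u\<close>; a Chevalley style argument shows that it is large enough.

  If \<open>a\<close> is a non-nilpotent element of \<open>J(R)\<close>, then modulo a prime of \<open>T\<close> that avoids \<open>a\<close> the units
  \<open>1 + a r\<close> provide such a \<open>u\<close>.  It follows that \<open>J(T)\<close> meets \<open>R\<close> trivially if \<open>T\<close> is not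
  submaximal, and that all residue fields of \<open>T\<close> are algebraic over a prime field, hence countable.
  Two distinct maximal ideals cannot have isomorphic residue fields, since the equalizer of the two
  residue maps would be a maximal subring.  So \<open>T\<close> has at most \<open>2\<close> to the \<open>\<aleph>\<^sub>0\<close> maximal ideals, and the
  reduced ring \<open>R\<close>, which embeds into the product of the residue fields, is too small.
\<close>

section \<open>Values of polynomials\<close>

context ring
begin

text \<open>The values at \<open>y\<close> of the polynomials over \<open>B\<close> of degree less than \<open>k\<close>.\<close>

primrec poly_values :: "'a set \<Rightarrow> 'a \<Rightarrow> nat \<Rightarrow> 'a set" where
  "poly_values B y 0 = {\<zero>}"
| "poly_values B y (Suc k) = {s \<oplus> y \<otimes> t | s t. s \<in> B \<and> t \<in> poly_values B y k}"

lemma poly_values_SucI: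
  "s \<in> B \<Longrightarrow> t \<in> poly_values B y k \<Longrightarrow> s \<oplus> y \<otimes> t \<in> poly_values B y (Suc k)"
  by auto

lemma poly_values_SucE:
  assumes "x \<in> poly_values B y (Suc k)"
  obtains s t where "s \<in> B" "t \<in> poly_values B y k" "x = s \<oplus> y \<otimes> t"
  using assms by auto

declare poly_values.simps(2) [simp del]

definition adjoin :: "'a set \<Rightarrow> 'a \<Rightarrow> 'a set" where
  "adjoin B y = (\<Union>k. poly_values B y k)"

end

lemma subring_minus:
  "subring B R \<Longrightarrow> x \<in> B \<Longrightarrow> y \<in> B \<Longrightarrow> x \<ominus>\<^bsub>R\<^esub> y \<in> B"
  unfolding a_minus_def by (simp add: subringE(5,7))

context cring
begin

context
  fixes B y
  assumes B: "subring B R" and y: "y \<in> carrier R"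
begin

lemma base_closed: "s \<in> B \<Longrightarrow> s \<in> carrier R"
  using subringE(1)[OF B] by blast

lemma poly_values_closed: "t \<in> poly_values B y k \<Longrightarrow> t \<in> carrier R"
  by (induction k arbitrary: t) (auto elim!: poly_values_SucE simp: base_closed y)

lemma poly_values_zero: "\<zero> \<in> poly_values B y k"
proof (induction k)
  case (Suc k)
  moreover have "\<zero> = \<zero> \<oplus> y \<otimes> \<zero>" using y by simp
  ultimately show ?case using subringE(2)[OF B] poly_values_SucI by metis
qed simp

lemma poly_values_add:
  "s \<in> poly_values B y k \<Longrightarrow> t \<in> poly_values B y k \<Longrightarrow> s \<oplus> t \<in> poly_values B y k"
proof (induction k arbitrary: s t)
  case (Suc k)
  then obtain s0 s1 t0 t1 where *: "s = s0 \<oplus> y \<otimes> s1" "t = t0 \<oplus> y \<otimes> t1" "s0 \<in> B" "t0 \<in> B"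
    "s1 \<in> poly_values B y k" "t1 \<in> poly_values B y k" by (metis poly_values_SucE)
  have "s \<oplus> t = (s0 \<oplus> t0) \<oplus> y \<otimes> (s1 \<oplus> t1)"
    using *(1,2) y *(3,4)[THEN base_closed] *(5,6)[THEN poly_values_closed]
    by algebra
  then show ?case using * Suc.IH[of s1 t1] subringE(7)[OF B] by (simp add: poly_values_SucI)
qed simp

lemma poly_values_smult:
  "s \<in> B \<Longrightarrow> t \<in> poly_values B y k \<Longrightarrow> s \<otimes> t \<in> poly_values B y k"
proof (induction k arbitrary: t)
  case 0
  then show ?case using base_closed by simp
next
  case (Suc k)
  then obtain t0 t1 where *: "t = t0 \<oplus> y \<otimes> t1" "t0 \<in> B" "t1 \<in> poly_values B y k"
    by (metis poly_values_SucE)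
  have "s \<otimes> t = (s \<otimes> t0) \<oplus> y \<otimes> (s \<otimes> t1)"
    using *(1) y Suc.prems(1)[THEN base_closed] *(2)[THEN base_closed] *(3)[THEN poly_values_closed]
    by algebra
  then show ?case using * Suc subringE(6)[OF B] by (simp add: poly_values_SucI)
qed

lemma poly_values_minus: "t \<in> poly_values B y k \<Longrightarrow> \<ominus> t \<in> poly_values B y k"
  using poly_values_smult[of "\<ominus> \<one>" t k] subringE(3,5)[OF B] poly_values_closed[of t k]
  by (simp add: l_minus)

lemma poly_values_Suc_mono: "t \<in> poly_values B y k \<Longrightarrow> t \<in> poly_values B y (Suc k)"
proof (induction k arbitrary: t)
  case 0
  then show ?case using poly_values_zero[of 1] by simp
next
  case (Suc k)
  then obtain t0 t1 where "t = t0 \<oplus> y \<otimes> t1" "t0 \<in> B" "t1 \<in> poly_values B y k"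
    by (metis poly_values_SucE)
  then show ?case using Suc.IH[of t1] by (simp add: poly_values_SucI)
qed

lemma poly_values_mono: "k \<le> l \<Longrightarrow> poly_values B y k \<subseteq> poly_values B y l"
  by (induction l rule: dec_induct) (auto intro: poly_values_Suc_mono)

lemma poly_values_shift: "t \<in> poly_values B y k \<Longrightarrow> y \<otimes> t \<in> poly_values B y (Suc k)"
  using poly_values_SucI[OF subringE(2)[OF B]] y poly_values_closed[of t k] by fastforce

lemma poly_values_const: "s \<in> B \<Longrightarrow> s \<in> poly_values B y (Suc k)"
  using poly_values_SucI[OF _ poly_values_zero[of k]] y base_closed by fastforce

lemma poly_values_pow_shift: "t \<in> poly_values B y k \<Longrightarrow> y [^] j \<otimes> t \<in> poly_values B y (j + k)"
proof (induction j)
  case 0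
  then show ?case using poly_values_closed[of t k] by simp
next
  case (Suc j)
  have "y [^] Suc j \<otimes> t = y \<otimes> (y [^] j \<otimes> t)"
    using y poly_values_closed[OF Suc.prems] by (simp add: m_ac)
  then show ?case using poly_values_shift[OF Suc.IH[OF Suc.prems]] by simp
qed

lemma poly_values_top:
  assumes "t \<in> poly_values B y k" "s \<in> B"
  shows "t \<oplus> s \<otimes> y [^] k \<in> poly_values B y (Suc k)"
proof -
  have "y [^] k \<otimes> s \<in> poly_values B y (k + Suc 0)"
    by (rule poly_values_pow_shift[OF poly_values_const[OF assms(2)]])
  then have "s \<otimes> y [^] k \<in> poly_values B y (Suc k)"
    using assms(2) y m_comm[of s "y [^] k"] base_closed by simp
  then show ?thesis using poly_values_add[OF poly_values_Suc_mono[OF assms(1)]] by blast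
qed

text \<open>The recursion peels off the constant coefficient. Here the coefficient of
  \<open>y [^] k\<close> is exposed instead, which is what arguments that lower the degree of a
  relation need.\<close>

lemma poly_values_topE:
  assumes "t \<in> poly_values B y (Suc k)"
  obtains t' s where "t' \<in> poly_values B y k" "s \<in> B" "t = t' \<oplus> s \<otimes> y [^] k"
proof -
  have "\<exists>t' s. t' \<in> poly_values B y k \<and> s \<in> B \<and> t = t' \<oplus> s \<otimes> y [^] k"
    using assms
  proof (induction k arbitrary: t)
    case 0
    then obtain s where "s \<in> B" "t = s \<oplus> y \<otimes> \<zero>"
      by (metis poly_values_SucE poly_values.simps(1) singletonD)
    then have "s \<in> B" "t = \<zero> \<oplus> s \<otimes> y [^] (0::nat)" using base_closed y by auto
    then show ?case by auto
  next
    case (Suc k)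
    from Suc.prems obtain t0 t1 where t: "t = t0 \<oplus> y \<otimes> t1" "t0 \<in> B" "t1 \<in> poly_values B y (Suc k)"
      by (metis poly_values_SucE)
    then obtain t' s where *: "t' \<in> poly_values B y k" "s \<in> B" "t1 = t' \<oplus> s \<otimes> y [^] k"
      using Suc.IH[of t1] by blast
    have "t = (t0 \<oplus> y \<otimes> t') \<oplus> s \<otimes> y [^] Suc k"
      using *(3) t(1) y *(2)[THEN base_closed] t(2)[THEN base_closed] *(1)[THEN poly_values_closed]
      by (simp add: r_distr a_assoc m_lcomm m_comm[of y])
    moreover have "t0 \<oplus> y \<otimes> t' \<in> poly_values B y (Suc k)"
      using * t by (simp add: poly_values_SucI)
    ultimately show ?case using * by blast
  qed
  then show thesis using that by blast
qed

lemma poly_values_mult: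
  "s \<in> poly_values B y k \<Longrightarrow> t \<in> poly_values B y l \<Longrightarrow> s \<otimes> t \<in> poly_values B y (k + l)"
proof (induction k arbitrary: s)
  case 0
  then show ?case using poly_values_zero poly_values_closed[of t l] by auto
next
  case (Suc k)
  then obtain s0 s1 where *: "s = s0 \<oplus> y \<otimes> s1" "s0 \<in> B" "s1 \<in> poly_values B y k"
    by (metis poly_values_SucE)
  have "s \<otimes> t = s0 \<otimes> t \<oplus> y \<otimes> (s1 \<otimes> t)"
    using *(1) y Suc.prems(2)[THEN poly_values_closed] *(2)[THEN base_closed]
      *(3)[THEN poly_values_closed] by algebra
  moreover have "s0 \<otimes> t \<in> poly_values B y (Suc k + l)"
    using poly_values_smult[OF *(2) Suc.prems(2)] poly_values_mono[of l "Suc k + l"] by auto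
  ultimately show ?case
    using poly_values_add[of "s0 \<otimes> t" "Suc k + l"] poly_values_shift[OF Suc.IH[OF *(3) Suc.prems(2)]]
    by simp
qed

lemma adjoin_subring: "subring (adjoin B y) R"
proof (rule subringI)
  show "adjoin B y \<subseteq> carrier R" unfolding adjoin_def using poly_values_closed by blast
  show "\<one> \<in> adjoin B y" unfolding adjoin_def using poly_values_const subringE(3)[OF B] by blast
  show "\<ominus> h \<in> adjoin B y" if "h \<in> adjoin B y" for h
    using that poly_values_minus unfolding adjoin_def by blast
  fix h1 h2 assume "h1 \<in> adjoin B y" "h2 \<in> adjoin B y"
  then obtain k l where kl: "h1 \<in> poly_values B y k" "h2 \<in> poly_values B y l"
    unfolding adjoin_def by blast
  show "h1 \<otimes> h2 \<in> adjoin B y" using poly_values_mult[OF kl] unfolding adjoin_def by blast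
  have "h1 \<in> poly_values B y (max k l)" "h2 \<in> poly_values B y (max k l)"
    using kl poly_values_mono[of k "max k l"] poly_values_mono[of l "max k l"] by auto
  then show "h1 \<oplus> h2 \<in> adjoin B y" using poly_values_add unfolding adjoin_def by blast
qed

lemma adjoin_base: "B \<subseteq> adjoin B y"
  using poly_values_const unfolding adjoin_def by blast

lemma adjoin_gen: "y \<in> adjoin B y"
  using poly_values_shift[OF poly_values_const[OF subringE(3)[OF B]]] y
  unfolding adjoin_def by (metis UN_I UNIV_I r_one)

lemma adjoinE:
  assumes "t \<in> adjoin B y"
  obtains k s t' where "s \<in> B" "t' \<in> poly_values B y k" "t = s \<oplus> y \<otimes> t'"
proof -
  obtain k where "t \<in> poly_values B y k" using assms unfolding adjoin_def by blast
  then have "t \<in> poly_values B y (Suc k)" by (rule poly_values_Suc_mono)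
  then show thesis using that by (metis poly_values_SucE)
qed

end

end

section \<open>Bases with a discrete valuation\<close>

lemma (in ring) subring_Union_directed:
  assumes "C \<noteq> {}" and sub: "\<And>V. V \<in> C \<Longrightarrow> subring V R"
    and dir: "\<And>V Y. V \<in> C \<Longrightarrow> Y \<in> C \<Longrightarrow> V \<subseteq> Y \<or> Y \<subseteq> V"
  shows "subring (\<Union>C) R"
proof (rule subringI)
  show "\<Union>C \<subseteq> carrier R" using subringE(1)[OF sub] by blast
  show "\<one> \<in> \<Union>C" using assms(1) subringE(3)[OF sub] by blast
  show "\<ominus> h \<in> \<Union>C" if "h \<in> \<Union>C" for h using that subringE(5)[OF sub] by blast
  fix h k assume "h \<in> \<Union>C" "k \<in> \<Union>C"
  then obtain V where V: "V \<in> C" "h \<in> V" "k \<in> V" using dir by blast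
  show "h \<otimes> k \<in> \<Union>C" "h \<oplus> k \<in> \<Union>C"
    using V subringE(6,7)[OF sub[OF V(1)]] by blast+
qed

text \<open>The witness is a polynomial of exact degree \<open>k\<close> with leading coefficient
  \<open>c\<close> vanishing at \<open>y\<close>, with its lower terms moved to the other side. For
  a subring \<open>B\<close> degree \<open>0\<close> rules itself out, since
  \<open>poly_values B y 0\<close> contains only zero.\<close>

definition (in ring) algebraic_over :: "'a set \<Rightarrow> 'a \<Rightarrow> bool" where
  "algebraic_over B y \<longleftrightarrow> (\<exists>k. \<exists>c\<in>B. c \<noteq> \<zero> \<and> c \<otimes> y [^] k \<in> poly_values B y k)"

text \<open>The leading coefficient of a polynomial that vanishes at a transcendental
  \<open>y\<close> must be zero, so the induction strips leading coefficients until only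
  \<open>s\<close> is left.\<close>

lemma (in cring) poly_values_unique:
  assumes B: "subring B R" and y: "y \<in> carrier R" and trans: "\<not> algebraic_over B y"
    and s: "s \<in> B" and m: "m \<in> poly_values B y k" and eq: "s \<oplus> y \<otimes> m = \<zero>"
  shows "s = \<zero> \<and> m = \<zero>"
  using m eq
proof (induction k arbitrary: m)
  case 0
  then show ?case using y base_closed[OF B y s] by simp
next
  case (Suc k)
  obtain m' c where m: "m' \<in> poly_values B y k" "c \<in> B" "m = m' \<oplus> c \<otimes> y [^] k"
    using poly_values_topE[OF B y Suc.prems(1)] by blast
  have cl: "s \<in> carrier R" "c \<in> carrier R" "m' \<in> carrier R"
    using base_closed[OF B y] poly_values_closed[OF B y] s m by auto
  have p: "y [^] k \<in> carrier R" using y by simp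
  have "c \<otimes> y [^] Suc k = y \<otimes> (c \<otimes> y [^] k)" using cl y by (simp add: m_ac)
  also have "\<dots> = \<ominus> (s \<oplus> y \<otimes> m') \<oplus> (s \<oplus> y \<otimes> m)"
    using cl y p m(3) by algebra
  finally have "c \<otimes> y [^] Suc k = \<ominus> (s \<oplus> y \<otimes> m') \<oplus> (s \<oplus> y \<otimes> m)" .
  then have "c \<otimes> y [^] Suc k = \<ominus> (s \<oplus> y \<otimes> m')"
    using Suc.prems(2) cl y by simp
  then have "c \<otimes> y [^] Suc k \<in> poly_values B y (Suc k)"
    using poly_values_minus[OF B y poly_values_SucI[OF s m(1)]] by simp
  then have "c = \<zero>" using trans m(2) unfolding algebraic_over_def by blast
  then have "m = m'" using m cl y by simp
  then show ?case using Suc.IH[OF m(1)] Suc.prems(2) by simp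
qed

lemma (in cring) poly_values_unique2:
  assumes B: "subring B R" and y: "y \<in> carrier R" and trans: "\<not> algebraic_over B y"
    and s: "s \<in> B" "s' \<in> B" and m: "m \<in> poly_values B y k" "m' \<in> poly_values B y l"
    and eq: "s \<oplus> y \<otimes> m = s' \<oplus> y \<otimes> m'"
  shows "s = s' \<and> m = m'"
proof -
  note cl = s[THEN base_closed[OF B y]] m[THEN poly_values_closed[OF B y]]
  have "(s \<ominus> s') \<oplus> y \<otimes> (m \<ominus> m') = (s \<oplus> y \<otimes> m) \<ominus> (s' \<oplus> y \<otimes> m')"
    using cl y by algebra
  also have "\<dots> = \<zero>" using cl y eq by simp
  finally have eq': "(s \<ominus> s') \<oplus> y \<otimes> (m \<ominus> m') = \<zero>" .
  have "m \<in> poly_values B y (max k l)" "m' \<in> poly_values B y (max k l)"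
    using m poly_values_mono[OF B y, of k "max k l"] poly_values_mono[OF B y, of l "max k l"] by auto
  then have "m \<ominus> m' \<in> poly_values B y (max k l)"
    unfolding a_minus_def using poly_values_add[OF B y] poly_values_minus[OF B y] by blast
  moreover have "s \<ominus> s' \<in> B" using subring_minus[OF B] s by blast
  ultimately have "s \<ominus> s' = \<zero> \<and> m \<ominus> m' = \<zero>"
    using poly_values_unique[OF B y trans _ _ eq'] by blast
  then show ?thesis using cl by (simp add: r_right_minus_eq)
qed

text \<open>The element \<open>u\<close> is prime in \<open>B\<close> and the \<open>u\<close>-adic filtration of \<open>B\<close> is separated, so that \<open>u\<close>
  defines a discrete valuation of the fraction field of \<open>B\<close>.\<close>

definition (in ring) gauss_subring :: "'a \<Rightarrow> 'a set \<Rightarrow> bool" where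
  "gauss_subring u B \<longleftrightarrow> subring B R \<and> u \<in> B \<and> \<one> \<notin> (\<otimes>) u ` B \<and>
     (\<forall>a\<in>B. \<forall>b\<in>B. a \<otimes> b \<in> (\<otimes>) u ` B \<longrightarrow> a \<in> (\<otimes>) u ` B \<or> b \<in> (\<otimes>) u ` B) \<and>
     (\<forall>b\<in>B. (\<forall>n::nat. b \<in> (\<otimes>) (u [^] n) ` B) \<longrightarrow> b = \<zero>)"

text \<open>Under plain inclusion, separatedness would be lost in unions of chains.\<close>

definition (in ring) pure_extension :: "'a \<Rightarrow> 'a set \<Rightarrow> 'a set \<Rightarrow> bool" where
  "pure_extension u A B \<longleftrightarrow> A \<subseteq> B \<and> (\<forall>x\<in>B. u \<otimes> x \<in> A \<longrightarrow> x \<in> A)"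

context domain
begin

lemma pure_extension_pow:
  assumes "pure_extension u A B" "subring B R" "u \<in> B" "x \<in> B" "u [^] (n::nat) \<otimes> x \<in> A"
  shows "x \<in> A"
  using assms(4,5)
proof (induction n arbitrary: x)
  case 0
  then show ?case using subringE(1)[OF assms(2)] by auto
next
  case (Suc n)
  have c: "u \<in> carrier R" "x \<in> carrier R" using subringE(1)[OF assms(2)] assms(3) Suc.prems by auto
  then have "u [^] n \<otimes> (u \<otimes> x) \<in> A" using Suc.prems(2) by (simp add: m_assoc)
  then have "u \<otimes> x \<in> A" using Suc.IH[of "u \<otimes> x"] subringE(6)[OF assms(2) assms(3) Suc.prems(1)] by blast
  then show ?case using assms(1) Suc.prems(1) unfolding pure_extension_def by blast
qed

text \<open>Zorn's lemma for \<open>pure_extension\<close>. In the union of a chain, primality of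
  \<open>u\<close> concerns three elements at a time and is decided in one member. Purity brings
  each quotient of \<open>b\<close> by a power of \<open>u\<close> back into the member that
  contains \<open>b\<close>, so separatedness is inherited as well.\<close>

lemma gauss_subring_maximal:
  assumes "gauss_subring u B0"
  obtains B where "gauss_subring u B"
    "\<And>B'. gauss_subring u B' \<Longrightarrow> pure_extension u B B' \<Longrightarrow> B' = B"
proof -
  let ?A = "{B. gauss_subring u B}"
  have "\<exists>B\<in>?A. \<forall>B'\<in>?A. pure_extension u B B' \<longrightarrow> B' = B"
  proof (rule predicate_Zorn)
    show "partial_order_on ?A (relation_of (pure_extension u) ?A)"
      by (rule partial_order_on_relation_ofI) (auto simp: pure_extension_def)
    fix C assume C: "C \<in> Chains (relation_of (pure_extension u) ?A)"
    show "\<exists>U\<in>?A. \<forall>V\<in>C. pure_extension u V U"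
    proof (cases "C = {}")
      case True
      then show ?thesis using assms by auto
    next
      case False
      have mem: "gauss_subring u V" if "V \<in> C" for V
        using C that unfolding Chains_def relation_of_def by auto
      have cmp: "pure_extension u V Y \<or> pure_extension u Y V" if "V \<in> C" "Y \<in> C" for V Y
        using C that unfolding Chains_def relation_of_def by auto
      have sub: "subring (\<Union>C) R"
      proof (intro subring_Union_directed False)
        show "subring V R" if "V \<in> C" for V using mem[OF that] unfolding gauss_subring_def by blast
        show "V \<subseteq> Y \<or> Y \<subseteq> V" if "V \<in> C" "Y \<in> C" for V Y
          using cmp[OF that] unfolding pure_extension_def by blast
      qed
      have pure: "pure_extension u V (\<Union>C)" if "V \<in> C" for V
        unfolding pure_extension_def using that cmp unfolding pure_extension_def by blast
      have u: "u \<in> \<Union>C" using False mem unfolding gauss_subring_def by blast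
      have "gauss_subring u (\<Union>C)"
        unfolding gauss_subring_def
      proof (intro conjI ballI impI sub u)
        show "\<one> \<notin> (\<otimes>) u ` \<Union>C" using mem unfolding gauss_subring_def by blast
      next
        fix a b assume "a \<in> \<Union>C" "b \<in> \<Union>C" "a \<otimes> b \<in> (\<otimes>) u ` \<Union>C"
        then obtain c V Y Z where XYZ: "a \<otimes> b = u \<otimes> c" "V \<in> C" "Y \<in> C" "Z \<in> C" "a \<in> V" "b \<in> Y" "c \<in> Z"
          by blast
        have dir: "A \<subseteq> A' \<or> A' \<subseteq> A" if "A \<in> C" "A' \<in> C" for A A'
          using cmp[OF that] unfolding pure_extension_def by blast
        have "V \<union> Y \<in> C" using dir[OF XYZ(2,3)] XYZ(2,3) by (auto simp: Un_absorb1 Un_absorb2)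
        then have "V \<union> Y \<union> Z \<in> C"
          using dir[of "V \<union> Y" Z] XYZ(4) by (metis Un_absorb1 Un_absorb2)
        then obtain W where W: "W \<in> C" "a \<in> W" "b \<in> W" "a \<otimes> b \<in> (\<otimes>) u ` W"
          using XYZ by blast
        then have "a \<in> (\<otimes>) u ` W \<or> b \<in> (\<otimes>) u ` W"
          using mem[OF W(1)] unfolding gauss_subring_def by blast
        then show "a \<in> (\<otimes>) u ` \<Union>C \<or> b \<in> (\<otimes>) u ` \<Union>C" using W(1) by blast
      next
        fix b assume "b \<in> \<Union>C" and div: "\<forall>n::nat. b \<in> (\<otimes>) (u [^] n) ` \<Union>C"
        then obtain V where V: "V \<in> C" "b \<in> V" by blast
        have "b \<in> (\<otimes>) (u [^] n) ` V" for n :: nat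
        proof -
          obtain c where "c \<in> \<Union>C" "b = u [^] n \<otimes> c" using div by blast
          then show ?thesis using pure_extension_pow[OF pure[OF V(1)] sub u, of c n] V(2) by auto
        qed
        then show "b = \<zero>" using mem[OF V(1)] V(2) unfolding gauss_subring_def by blast
      qed
      then show ?thesis using pure by blast
    qed
  qed
  then show thesis using that by auto
qed

text \<open>Gauss's lemma: since \<open>y\<close> is transcendental over \<open>B\<close>,
  coefficients are unique and divisibility by powers of \<open>u\<close> can be tested on them.
  Purity holds because a product \<open>u x\<close> that is constant in \<open>y\<close> forces
  \<open>x\<close> to be constant.\<close>

lemma gauss_subring_adjoin:
  assumes G: "gauss_subring u B" and u: "u \<noteq> \<zero>" and y: "y \<in> carrier R"
    and trans: "\<not> algebraic_over B y"
  shows "gauss_subring u (adjoin B y)" "pure_extension u B (adjoin B y)"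
proof -
  have B: "subring B R" and uB: "u \<in> B" and one: "\<one> \<notin> (\<otimes>) u ` B"
    and prime: "\<And>a b. a \<in> B \<Longrightarrow> b \<in> B \<Longrightarrow> a \<otimes> b \<in> (\<otimes>) u ` B \<Longrightarrow> a \<in> (\<otimes>) u ` B \<or> b \<in> (\<otimes>) u ` B"
    and sep: "\<And>b. b \<in> B \<Longrightarrow> (\<And>n::nat. b \<in> (\<otimes>) (u [^] n) ` B) \<Longrightarrow> b = \<zero>"
    using G unfolding gauss_subring_def by blast+
  have uR: "u \<in> carrier R" using base_closed[OF B y uB] .
  note uniq = poly_values_unique2[OF B y trans]
  note cl = base_closed[OF B y] poly_values_closed[OF B y]
  let ?A = "adjoin B y"
  note A = adjoin_subring[OF B y]
  have uA: "u \<in> ?A" using adjoin_base[OF B y] uB by blast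
  have y0: "y \<noteq> \<zero>"
  proof
    assume "y = \<zero>"
    then have "\<one> \<otimes> y [^] Suc 0 \<in> poly_values B y (Suc 0)" using poly_values_zero[OF B y] by simp
    then show False using trans subringE(3)[OF B] one_not_zero unfolding algebraic_over_def by blast
  qed
  have AE: "\<exists>k s t. s \<in> B \<and> t \<in> poly_values B y k \<and> x = s \<oplus> y \<otimes> t" if "x \<in> ?A" for x
    using adjoinE[OF B y that] by metis
  \<comment> \<open>Comparison of coefficients: a factor \<open>v\<close> from \<open>B\<close>
    divides the constant term and the remainder separately.\<close>
  have coeffs: "\<exists>c0\<in>B. \<exists>c1\<in>?A. s = v \<otimes> c0 \<and> t = v \<otimes> c1"
    if x: "s \<in> B" "t \<in> poly_values B y k" "s \<oplus> y \<otimes> t = v \<otimes> c" "c \<in> ?A" "v \<in> B" for s t v c k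
  proof -
    obtain l c0 c1 where c: "c0 \<in> B" "c1 \<in> poly_values B y l" "c = c0 \<oplus> y \<otimes> c1"
      using AE[OF x(4)] by blast
    have "s \<oplus> y \<otimes> t = v \<otimes> c0 \<oplus> y \<otimes> (v \<otimes> c1)"
      using x(3) c(3) y cl(1)[OF c(1)] cl(2)[OF c(2)] cl(1)[OF x(5)] by algebra
    then have "s = v \<otimes> c0 \<and> t = v \<otimes> c1"
      by (intro uniq[OF x(1) _ x(2) poly_values_smult[OF B y x(5) c(2)]])
         (use subringE(6)[OF B] x c in auto)
    then show ?thesis using c unfolding adjoin_def by blast
  qed
  show "pure_extension u B ?A"
    unfolding pure_extension_def
  proof (intro conjI ballI impI adjoin_base[OF B y])
    fix x assume x: "x \<in> ?A" "u \<otimes> x \<in> B"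
    obtain k s t where st: "s \<in> B" "t \<in> poly_values B y k" "x = s \<oplus> y \<otimes> t" using AE[OF x(1)] by blast
    note c = cl(1)[OF st(1)] cl(2)[OF st(2)]
    have "u \<otimes> s \<oplus> y \<otimes> (u \<otimes> t) = (u \<otimes> x) \<oplus> y \<otimes> \<zero>"
      using c uR y st(3) by (simp add: r_distr m_lcomm)
    then have "u \<otimes> t = \<zero>"
      using uniq[OF subringE(6)[OF B uB st(1)] x(2) poly_values_smult[OF B y uB st(2)]
          poly_values_zero[OF B y]] by blast
    then have "t = \<zero>" using u uR c integral by blast
    then show "x \<in> B" using st y c by simp
  qed
  show "gauss_subring u ?A"
    unfolding gauss_subring_def
  proof (intro conjI ballI impI A uA)
    show "\<one> \<notin> (\<otimes>) u ` ?A"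
    proof
      assume "\<one> \<in> (\<otimes>) u ` ?A"
      then obtain c where c: "c \<in> ?A" "\<one> = u \<otimes> c" by blast
      have "\<one> \<oplus> y \<otimes> \<zero> = \<one>" using y by simp
      then have "\<one> \<oplus> y \<otimes> \<zero> = u \<otimes> c" using c(2) by simp
      then obtain c0 where "c0 \<in> B" "\<one> = u \<otimes> c0"
        using coeffs[OF subringE(3)[OF B] poly_values_zero[OF B y] _ c(1) uB] by blast
      then show False using one by blast
    qed
  next
    fix b assume b: "b \<in> ?A" "\<forall>n::nat. b \<in> (\<otimes>) (u [^] n) ` ?A"
    have un: "u [^] n \<in> B" for n :: nat
      using uB subringE(3,6)[OF B] by (induction n) auto
    have "t = \<zero>" if "t \<in> poly_values B y k" "\<And>n::nat. t \<in> (\<otimes>) (u [^] n) ` ?A" for t k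
      using that
    proof (induction k arbitrary: t)
      case (Suc k)
      obtain s t' where t: "s \<in> B" "t' \<in> poly_values B y k" "t = s \<oplus> y \<otimes> t'"
        using poly_values_SucE[OF Suc.prems(1)] by metis
      have *: "s \<in> (\<otimes>) (u [^] n) ` B \<and> t' \<in> (\<otimes>) (u [^] n) ` ?A" for n :: nat
      proof -
        obtain c where "c \<in> ?A" "t = u [^] n \<otimes> c" using Suc.prems(2)[of n] by blast
        then have "\<exists>c0\<in>B. \<exists>c1\<in>?A. s = u [^] n \<otimes> c0 \<and> t' = u [^] n \<otimes> c1"
          using coeffs[OF t(1,2) _ _ un, of n c] t(3) by simp
        then show ?thesis by blast
      qed
      have "s = \<zero>" "t' = \<zero>" using sep[OF t(1)] Suc.IH[OF t(2)] * by blast+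
      then show ?case using t y by simp
    qed simp
    then show "b = \<zero>" using b unfolding adjoin_def by blast
  next
    \<comment> \<open>The constant term of \<open>a b\<close> is \<open>a0 b0\<close>, so
      \<open>u\<close> divides one factor of it, say \<open>a0\<close>. Subtracting
      \<open>a0 b\<close> and cancelling \<open>y\<close> leaves \<open>u\<close> dividing
      \<open>a1 b\<close>, where the total length is smaller; if \<open>u\<close> divides
      \<open>a1\<close>, then it divides \<open>a\<close>.\<close>
    have aux: "a \<in> (\<otimes>) u ` ?A \<or> b \<in> (\<otimes>) u ` ?A"
      if "a \<in> poly_values B y k" "b \<in> poly_values B y l" "a \<otimes> b \<in> (\<otimes>) u ` ?A" for a b k l
      using that
    proof (induction "k + l" arbitrary: a b k l rule: less_induct)
      case less
      note a = less.prems(1) and b = less.prems(2) and ab = less.prems(3)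
      have z: "\<zero> \<in> (\<otimes>) u ` ?A" using subringE(2)[OF A] uR by (intro image_eqI[of _ _ \<zero>]) auto
      show ?case
      proof (cases "k = 0 \<or> l = 0")
        case True
        then show ?thesis using a b z by auto
      next
        case False
        then obtain k' l' where kl: "k = Suc k'" "l = Suc l'" by (metis not0_implies_Suc)
        obtain a0 a1 where a': "a0 \<in> B" "a1 \<in> poly_values B y k'" "a = a0 \<oplus> y \<otimes> a1"
          using poly_values_SucE a kl by metis
        obtain b0 b1 where b': "b0 \<in> B" "b1 \<in> poly_values B y l'" "b = b0 \<oplus> y \<otimes> b1"
          using poly_values_SucE b kl by metis
        obtain c where c: "c \<in> ?A" "a \<otimes> b = u \<otimes> c" using ab by blast
        note cls = cl(1)[OF a'(1)] cl(2)[OF a'(2)] cl(1)[OF b'(1)] cl(2)[OF b'(2)] y uR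
        have cR: "c \<in> carrier R" using c(1) subringE(1)[OF A] by blast
        have mem: "a0 \<otimes> b1 \<oplus> a1 \<otimes> b \<in> ?A"
        proof -
          have "a0 \<in> ?A" "b1 \<in> ?A" "a1 \<in> ?A" "b \<in> ?A"
            using a' b' b adjoin_base[OF B y] unfolding adjoin_def by blast+
          then show ?thesis by (intro subringE(6)[OF A] subringE(7)[OF A])
        qed
        then obtain j where j: "a0 \<otimes> b1 \<oplus> a1 \<otimes> b \<in> poly_values B y j" unfolding adjoin_def by blast
        have "a0 \<otimes> b0 \<oplus> y \<otimes> (a0 \<otimes> b1 \<oplus> a1 \<otimes> b) = u \<otimes> c"
          using c(2) cls cR a'(3) b'(3) by algebra
        then have "a0 \<otimes> b0 \<in> (\<otimes>) u ` B"
          using coeffs[OF subringE(6)[OF B a'(1) b'(1)] j _ c(1) uB] by blast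
        then consider "a0 \<in> (\<otimes>) u ` B" | "b0 \<in> (\<otimes>) u ` B" using prime a' b' by blast
        then show ?thesis
        proof cases
          case 1
          then obtain d where d: "d \<in> B" "a0 = u \<otimes> d" by blast
          have dR: "d \<in> carrier R" using cl(1)[OF d(1)] .
          have dA: "d \<in> ?A" "b \<in> ?A" using d b adjoin_base[OF B y] unfolding adjoin_def by blast+
          have "\<zero> \<oplus> y \<otimes> (a1 \<otimes> b) = a \<otimes> b \<ominus> a0 \<otimes> b"
            using cls a'(3) b'(3) by algebra
          also have "\<dots> = u \<otimes> (c \<ominus> d \<otimes> b)"
            using c(2) d(2) cR dR cls b'(3) by algebra
          finally have eq: "\<zero> \<oplus> y \<otimes> (a1 \<otimes> b) = u \<otimes> (c \<ominus> d \<otimes> b)" .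
          have "c \<ominus> d \<otimes> b \<in> ?A"
            by (intro subring_minus[OF A] subringE(6)[OF A] c(1) dA)
          then have "a1 \<otimes> b \<in> (\<otimes>) u ` ?A"
            using coeffs[OF subringE(2)[OF B] poly_values_mult[OF B y a'(2) b] eq _ uB] by blast
          then consider "a1 \<in> (\<otimes>) u ` ?A" | "b \<in> (\<otimes>) u ` ?A"
            using less.hyps[of k' l a1 b] a'(2) b kl by auto
          then show ?thesis
          proof cases
            case 1
            then obtain e where e: "e \<in> ?A" "a1 = u \<otimes> e" by blast
            have eR: "e \<in> carrier R" using e(1) subringE(1)[OF A] by blast
            have "a = u \<otimes> (d \<oplus> y \<otimes> e)" using a'(3) d(2) e(2) dR eR y uR by algebra
            moreover have "d \<oplus> y \<otimes> e \<in> ?A"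
              by (intro subringE(6)[OF A] subringE(7)[OF A] dA(1) e(1) adjoin_gen[OF B y])
            ultimately show ?thesis by blast
          qed blast
        next
          case 2
          then obtain d where d: "d \<in> B" "b0 = u \<otimes> d" by blast
          have dR: "d \<in> carrier R" using cl(1)[OF d(1)] .
          have dA: "d \<in> ?A" "a \<in> ?A" using d a adjoin_base[OF B y] unfolding adjoin_def by blast+
          have "\<zero> \<oplus> y \<otimes> (a \<otimes> b1) = a \<otimes> b \<ominus> a \<otimes> b0"
            using cls a'(3) b'(3) by algebra
          also have "\<dots> = u \<otimes> (c \<ominus> a \<otimes> d)"
            using c(2) d(2) cR dR cls a'(3) by algebra
          finally have eq: "\<zero> \<oplus> y \<otimes> (a \<otimes> b1) = u \<otimes> (c \<ominus> a \<otimes> d)" .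
          have "c \<ominus> a \<otimes> d \<in> ?A"
            by (intro subring_minus[OF A] subringE(6)[OF A] c(1) dA)
          then have "a \<otimes> b1 \<in> (\<otimes>) u ` ?A"
            using coeffs[OF subringE(2)[OF B] poly_values_mult[OF B y a b'(2)] eq _ uB] by blast
          then consider "a \<in> (\<otimes>) u ` ?A" | "b1 \<in> (\<otimes>) u ` ?A"
            using less.hyps[of k l' a b1] b'(2) a kl by auto
          then show ?thesis
          proof cases
            case 2
            then obtain e where e: "e \<in> ?A" "b1 = u \<otimes> e" by blast
            have eR: "e \<in> carrier R" using e(1) subringE(1)[OF A] by blast
            have "b = u \<otimes> (d \<oplus> y \<otimes> e)" using b'(3) d(2) e(2) dR eR y uR by algebra
            moreover have "d \<oplus> y \<otimes> e \<in> ?A"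
              by (intro subringE(6)[OF A] subringE(7)[OF A] dA(1) e(1) adjoin_gen[OF B y])
            ultimately show ?thesis by blast
          qed blast
        qed
      qed
    qed
    fix a b assume "a \<in> ?A" "b \<in> ?A" "a \<otimes> b \<in> (\<otimes>) u ` ?A"
    then show "a \<in> (\<otimes>) u ` ?A \<or> b \<in> (\<otimes>) u ` ?A" using aux unfolding adjoin_def by blast
  qed
qed

text \<open>A transcendental element could be adjoined to a maximal \<open>B\<close>, and the result
  would be a proper pure extension.\<close>

lemma gauss_subring_algebraic:
  assumes "gauss_subring u B0" "u \<noteq> \<zero>"
  obtains B where "gauss_subring u B" "\<And>y. y \<in> carrier R \<Longrightarrow> algebraic_over B y"
proof -
  obtain B where B: "gauss_subring u B"
    "\<And>B'. gauss_subring u B' \<Longrightarrow> pure_extension u B B' \<Longrightarrow> B' = B"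
    using gauss_subring_maximal[OF assms(1)] by blast
  have sub: "subring B R" using B(1) unfolding gauss_subring_def by blast
  have "algebraic_over B y" if y: "y \<in> carrier R" for y
  proof (rule ccontr)
    assume na: "\<not> algebraic_over B y"
    then have "adjoin B y = B" using gauss_subring_adjoin[OF B(1) assms(2) y] B(2) by blast
    then have "y \<in> B" using adjoin_gen[OF sub y] by simp
    then have "\<one> \<otimes> y [^] Suc 0 \<in> poly_values B y (Suc 0)"
      using poly_values_const[OF sub y] y by simp
    then show False using na subringE(3)[OF sub] unfolding algebraic_over_def by (metis one_not_zero)
  qed
  then show thesis using that B by blast
qed

end

section \<open>Subrings dominated by a unit\<close>

text \<open>This serves twice: with a set \<open>V\<close> of forbidden quotients by
  \<open>u\<close> to build a valuation-like subring, and with \<open>V = {inv u}\<close> to build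
  the maximal subring itself.\<close>

lemma (in ring) subring_avoiding_maximal:
  assumes "subring S R" "S \<inter> V = {}"
  obtains M where "subring M R" "S \<subseteq> M" "M \<inter> V = {}"
    "\<And>N. subring N R \<Longrightarrow> M \<subset> N \<Longrightarrow> N \<inter> V \<noteq> {}"
proof -
  let ?A = "{N. subring N R \<and> S \<subseteq> N \<and> N \<inter> V = {}}"
  have "\<exists>M\<in>?A. \<forall>N\<in>?A. M \<subseteq> N \<longrightarrow> N = M"
  proof (rule subset_Zorn_nonempty)
    show "?A \<noteq> {}" using assms by blast
    fix C assume C: "C \<noteq> {}" "subset.chain ?A C"
    have "subring (\<Union>C) R"
    proof (rule subring_Union_directed[OF C(1)])
      show "subring N R" if "N \<in> C" for N using that C(2) unfolding subset.chain_def by blast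
      show "N \<subseteq> N' \<or> N' \<subseteq> N" if "N \<in> C" "N' \<in> C" for N N'
        using that C(2) unfolding subset.chain_def by blast
    qed
    then show "\<Union>C \<in> ?A" using C by (auto simp: subset.chain_def)
  qed
  then obtain M where M: "M \<in> ?A" "\<forall>N\<in>?A. M \<subseteq> N \<longrightarrow> N = M" by blast
  show thesis by (rule that[of M]) (use M in auto)
qed

lemma (in cring) poly_values_base_mono:
  "B \<subseteq> S \<Longrightarrow> poly_values B y k \<subseteq> poly_values S y k"
proof (induction k)
  case (Suc k)
  then show ?case by (auto elim!: poly_values_SucE intro!: poly_values_SucI)
qed simp

text \<open>The coefficient of \<open>y [^] i\<close> acquires the factor
  \<open>u [^] (j - i)\<close> when the rest of \<open>u [^] j\<close> is absorbed into the power of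
  \<open>u y\<close>. The bound \<open>k \<le> Suc j\<close> keeps these exponents
  nonnegative.\<close>

lemma (in cring) poly_values_scale:
  assumes B: "subring B R" and y: "y \<in> carrier R" and u: "u \<in> B"
  shows "t \<in> poly_values B y k \<Longrightarrow> k \<le> Suc j \<Longrightarrow> u [^] j \<otimes> t \<in> poly_values B (u \<otimes> y) k"
proof (induction k arbitrary: t j)
  case 0
  then show ?case using base_closed[OF B y u] by simp
next
  case (Suc k)
  have un: "u [^] n \<in> B" for n :: nat
    using u subringE(3,6)[OF B] by (induction n) auto
  have uR: "u \<in> carrier R" using base_closed[OF B y u] .
  have uy: "u \<otimes> y \<in> carrier R" using uR y by simp
  obtain s t' where t: "s \<in> B" "t' \<in> poly_values B y k" "t = s \<oplus> y \<otimes> t'"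
    using poly_values_SucE[OF Suc.prems(1)] by metis
  note cl = base_closed[OF B y t(1)] poly_values_closed[OF B y t(2)]
  show ?case
  proof (cases j)
    case 0
    then have "t' = \<zero>" using t(2) Suc.prems(2) by simp
    then have "u [^] j \<otimes> t = s" using 0 t(3) cl y by simp
    then show ?thesis using poly_values_const[OF B uy t(1)] by simp
  next
    case (Suc i)
    have "u [^] j \<otimes> t = u [^] j \<otimes> s \<oplus> (u \<otimes> y) \<otimes> (u [^] i \<otimes> t')"
      using cl y uR t(3) Suc by (simp add: r_distr m_ac)
    moreover have "u [^] i \<otimes> t' \<in> poly_values B (u \<otimes> y) k"
      using Suc.IH[OF t(2)] Suc.prems(2) Suc by simp
    ultimately show ?thesis
      using poly_values_SucI[OF subringE(6)[OF B un t(1)]] by metis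
  qed
qed

text \<open>With \<open>n\<close> and \<open>m\<close> minimal such that \<open>a y\<^sup>n\<close> (\<open>a \<in> W\<close>) has degree below \<open>n\<close> in \<open>y\<close>, and \<open>W\<close> contains some
  \<open>u y f(y)\<close> with \<open>f\<close> of degree below \<open>m\<close>, each of the two relations can be used to shorten the other.\<close>

lemma (in domain) integral_over_max_subring:
  assumes S: "subring S R" and V: "\<And>N. subring N R \<Longrightarrow> S \<subset> N \<Longrightarrow> N \<inter> V \<noteq> {}"
    and W: "W \<subseteq> S" "\<zero> \<notin> W" "\<And>v w. v \<in> W \<Longrightarrow> w \<in> W \<Longrightarrow> v \<otimes> w \<in> W"
    and u: "u \<in> S" and W_diff: "\<And>w s. w \<in> W \<Longrightarrow> s \<in> S \<Longrightarrow> w \<ominus> u \<otimes> s \<in> W"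
    and VW: "\<And>x. x \<in> V \<Longrightarrow> u \<otimes> x \<in> W"
    and y: "y \<in> carrier R" and c: "c \<in> W" "c \<otimes> y [^] k \<in> poly_values S y k"
  shows "y \<in> S"
proof (rule ccontr)
  assume yS: "y \<notin> S"
  note cl = base_closed[OF S y] poly_values_closed[OF S y]
  have uR: "u \<in> carrier R" using cl(1)[OF u] .
  have WR: "w \<in> carrier R" if "w \<in> W" for w using cl(1) W(1) that by blast
  have y0: "y \<noteq> \<zero>" using yS subringE(2)[OF S] by blast
  \<comment> \<open>By maximality of \<open>S\<close>, adjoining \<open>y\<close> produces an
    element of \<open>V\<close>. Multiplied by \<open>u\<close> and freed of its constant term, it
    becomes a relation \<open>u y t\<close> in \<open>W\<close>.\<close>
  have "S \<subset> adjoin S y" using adjoin_base[OF S y] adjoin_gen[OF S y] yS by blast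
  then obtain x where x: "x \<in> adjoin S y" "x \<in> V" using V[OF adjoin_subring[OF S y]] by blast
  obtain l s t where st: "s \<in> S" "t \<in> poly_values S y l" "x = s \<oplus> y \<otimes> t"
    using adjoinE[OF S y x(1)] by metis
  have "u \<otimes> x \<ominus> u \<otimes> s = u \<otimes> (y \<otimes> t)"
    using st(3) cl(1)[OF st(1)] cl(2)[OF st(2)] uR y by algebra
  then have ex_m: "\<exists>t\<in>poly_values S y l. u \<otimes> (y \<otimes> t) \<in> W"
    using W_diff[OF VW[OF x(2)] st(1)] st(2) by auto
  define m where "m = (LEAST m. \<exists>t\<in>poly_values S y m. u \<otimes> (y \<otimes> t) \<in> W)"
  have m: "\<exists>t\<in>poly_values S y m. u \<otimes> (y \<otimes> t) \<in> W"
    unfolding m_def by (rule LeastI[of _ l]) (rule ex_m)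
  have m_min: "m \<le> m'" if "t \<in> poly_values S y m'" "u \<otimes> (y \<otimes> t) \<in> W" for m' t
    unfolding m_def by (rule Least_le) (use that in blast)
  define n where "n = (LEAST n. \<exists>c\<in>W. c \<otimes> y [^] n \<in> poly_values S y n)"
  have n: "\<exists>c\<in>W. c \<otimes> y [^] n \<in> poly_values S y n"
    unfolding n_def by (rule LeastI[of _ k]) (use c in blast)
  have n_min: "n \<le> n'" if "c \<in> W" "c \<otimes> y [^] n' \<in> poly_values S y n'" for n' c
    unfolding n_def by (rule Least_le) (use that in blast)
  obtain t where t: "t \<in> poly_values S y m" "u \<otimes> (y \<otimes> t) \<in> W" using m by blast
  obtain a where a: "a \<in> W" "a \<otimes> y [^] n \<in> poly_values S y n" using n by blast
  have n0: "n \<noteq> 0"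
  proof
    assume "n = 0"
    then have "a = \<zero>" using a WR[OF a(1)] by simp
    then show False using a(1) W(2) by simp
  qed
  have m0: "m \<noteq> 0"
  proof
    assume "m = 0"
    then have "u \<otimes> (y \<otimes> t) = \<zero>" using t(1) uR y by simp
    then show False using t(2) W(2) by simp
  qed
  obtain m' where m': "m = Suc m'" using m0 not0_implies_Suc by blast
  obtain n' where n': "n = Suc n'" using n0 not0_implies_Suc by blast
  show False
  proof (cases "n \<le> m")
    case True
    \<comment> \<open>The relation for \<open>a\<close> shortens \<open>t\<close>: in
      \<open>a u y t\<close> the top term contains \<open>a y [^] m\<close>, which is rewritten as
      \<open>s0 + y t0\<close>. The constant \<open>u s s0\<close> is subtracted without leaving
      \<open>W\<close>, and what remains is \<open>u y\<close> times a value of length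
      \<open>m'\<close>.\<close>
    obtain t' s where ts: "t' \<in> poly_values S y m'" "s \<in> S" "t = t' \<oplus> s \<otimes> y [^] m'"
      using poly_values_topE[OF S y] t(1) m' by metis
    have "y [^] (m - n) \<otimes> (a \<otimes> y [^] n) \<in> poly_values S y m"
      using poly_values_pow_shift[OF S y a(2), of "m - n"] True by simp
    moreover have "y [^] (m - n) \<otimes> (a \<otimes> y [^] n) = a \<otimes> y [^] m"
    proof -
      have "y [^] (m - n) \<otimes> (a \<otimes> y [^] n) = a \<otimes> (y [^] (m - n) \<otimes> y [^] n)"
        using y WR[OF a(1)] by (simp add: m_lcomm)
      then show ?thesis using y True by (simp add: nat_pow_mult)
    qed
    ultimately have am: "a \<otimes> y [^] m \<in> poly_values S y (Suc m')" using m' by simp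
    obtain s0 t0 where st0: "s0 \<in> S" "t0 \<in> poly_values S y m'" "a \<otimes> y [^] m = s0 \<oplus> y \<otimes> t0"
      using poly_values_SucE[OF am] by metis
    have R: "y [^] m' \<in> carrier R" "a \<in> carrier R" "t' \<in> carrier R" "s \<in> carrier R"
      "s0 \<in> carrier R" "t0 \<in> carrier R"
      using y WR[OF a(1)] cl ts st0 by auto
    have am': "a \<otimes> (y \<otimes> y [^] m') = s0 \<oplus> y \<otimes> t0"
      using st0(3) m' R y by (simp add: m_comm)
    have "a \<otimes> (u \<otimes> (y \<otimes> t)) = u \<otimes> (y \<otimes> (a \<otimes> t')) \<oplus> u \<otimes> s \<otimes> (a \<otimes> (y \<otimes> y [^] m'))"
      using ts(3) R y uR by algebra
    also have "\<dots> = u \<otimes> (y \<otimes> (a \<otimes> t' \<oplus> s \<otimes> t0)) \<oplus> u \<otimes> (s \<otimes> s0)"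
      unfolding am' using R y uR by algebra
    finally have "a \<otimes> (u \<otimes> (y \<otimes> t)) \<ominus> u \<otimes> (s \<otimes> s0) = u \<otimes> (y \<otimes> (a \<otimes> t' \<oplus> s \<otimes> t0))"
      using R y uR by (simp add: a_minus_def a_assoc r_neg)
    moreover have "a \<otimes> (u \<otimes> (y \<otimes> t)) \<ominus> u \<otimes> (s \<otimes> s0) \<in> W"
      using W_diff[OF W(3)[OF a(1) t(2)]] subringE(6)[OF S] ts(2) st0(1) by blast
    moreover have "a \<otimes> t' \<oplus> s \<otimes> t0 \<in> poly_values S y m'"
      using poly_values_add[OF S y poly_values_smult[OF S y _ ts(1)] poly_values_smult[OF S y ts(2) st0(2)]]
        a(1) W(1) by blast
    ultimately have "m \<le> m'" using m_min by metis
    then show False using m' by simp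
  next
    case False
    then have mn: "m \<le> n'" using n' by simp
    \<comment> \<open>The element \<open>u y t\<close> of \<open>W\<close> shortens the relation for
      \<open>a\<close>: after multiplication by it, the constant term \<open>s0\<close> carries a
      factor \<open>y\<close>. Cancelling \<open>y\<close> gives a relation of degree
      \<open>n'\<close> with leading coefficient in \<open>W\<close>; it is short enough because
      \<open>t\<close> has length \<open>m \<le> n'\<close>.\<close>
    obtain s0 t0 where st0: "s0 \<in> S" "t0 \<in> poly_values S y n'" "a \<otimes> y [^] n = s0 \<oplus> y \<otimes> t0"
      using poly_values_SucE a(2) n' by metis
    let ?w = "u \<otimes> (y \<otimes> t)"
    have R: "y [^] n' \<in> carrier R" "a \<in> carrier R" "t \<in> carrier R" 
      "s0 \<in> carrier R" "t0 \<in> carrier R"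
      using y WR[OF a(1)] cl t(1) st0 by auto
    have an: "a \<otimes> (y \<otimes> y [^] n') = s0 \<oplus> y \<otimes> t0"
      using st0(3) n' R y by (simp add: m_comm)
    have "y \<otimes> (?w \<otimes> a \<otimes> y [^] n') = ?w \<otimes> (a \<otimes> (y \<otimes> y [^] n'))"
      using R y uR by algebra
    also have "\<dots> = y \<otimes> (u \<otimes> s0 \<otimes> t \<oplus> ?w \<otimes> t0)"
      unfolding an using R y uR by algebra
    finally have "?w \<otimes> a \<otimes> y [^] n' = u \<otimes> s0 \<otimes> t \<oplus> ?w \<otimes> t0"
      using m_lcancel[OF y0 y] R y uR by simp
    moreover have "u \<otimes> s0 \<otimes> t \<oplus> ?w \<otimes> t0 \<in> poly_values S y n'"
    proof (rule poly_values_add[OF S y])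
      show "u \<otimes> s0 \<otimes> t \<in> poly_values S y n'"
        using poly_values_smult[OF S y subringE(6)[OF S u st0(1)]] t(1) poly_values_mono[OF S y mn] by blast
      show "?w \<otimes> t0 \<in> poly_values S y n'"
        using poly_values_smult[OF S y _ st0(2)] t(2) W(1) by blast
    qed
    ultimately have "n \<le> n'" using n_min[OF W(3)[OF t(2) a(1)], of n'] by simp
    then show False using n' by simp
  qed
qed

lemma (in domain) Units_nonzero: "u \<in> Units R \<Longrightarrow> u \<noteq> \<zero>"
  using Units_l_inv[of u] Units_inv_closed[of u] zero_not_one by (metis r_null)

text \<open>Chevalley's extension argument. A subring \<open>S\<close> maximal with trace
  \<open>uB\<close> of \<open>uS\<close> on \<open>B\<close> contains each \<open>y\<close>
  satisfying a relation over \<open>B\<close> whose leading coefficient is not divisible by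
  \<open>u\<close>. For arbitrary \<open>y\<close> the leading coefficient is a power of
  \<open>u\<close> times such an element, and multiplying \<open>y\<close> by that power of
  \<open>u\<close> removes the excess.\<close>

lemma (in domain) gauss_subring_dominating:
  assumes G: "gauss_subring u B" and alg: "\<And>y. y \<in> carrier R \<Longrightarrow> algebraic_over B y"
    and u: "u \<in> Units R"
  obtains S where "subring S R" "u \<in> S" "inv u \<notin> S"
    "\<And>y. y \<in> carrier R \<Longrightarrow> \<exists>n::nat. u [^] n \<otimes> y \<in> S"
proof -
  have B: "subring B R" and uB: "u \<in> B" and one: "\<one> \<notin> (\<otimes>) u ` B"
    and prime: "\<And>a b. a \<in> B \<Longrightarrow> b \<in> B \<Longrightarrow> a \<otimes> b \<in> (\<otimes>) u ` B \<Longrightarrow> a \<in> (\<otimes>) u ` B \<or> b \<in> (\<otimes>) u ` B"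
    and sep: "\<And>b. b \<in> B \<Longrightarrow> (\<And>n::nat. b \<in> (\<otimes>) (u [^] n) ` B) \<Longrightarrow> b = \<zero>"
    using G unfolding gauss_subring_def by blast+
  have uR: "u \<in> carrier R" and u0: "u \<noteq> \<zero>"
    using u Units_nonzero by auto
  have BR: "b \<in> carrier R" if "b \<in> B" for b using that subringE(1)[OF B] by blast
  \<comment> \<open>Avoiding \<open>V\<close> means that \<open>uS \<inter> B = uB\<close>.\<close>
  define V where "V = {x \<in> carrier R. u \<otimes> x \<in> B \<and> x \<notin> B}"
  have "B \<inter> V = {}" unfolding V_def by blast
  then obtain S where S: "subring S R" "B \<subseteq> S" "S \<inter> V = {}"
    "\<And>N. subring N R \<Longrightarrow> S \<subset> N \<Longrightarrow> N \<inter> V \<noteq> {}"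
    using subring_avoiding_maximal[OF B] by metis
  have SR: "s \<in> carrier R" if "s \<in> S" for s using that subringE(1)[OF S(1)] by blast
  have uS: "u \<in> S" using uB S(2) by blast
  define P where "P = B - (\<otimes>) u ` B"
  \<comment> \<open>\<open>W\<close> consists of the elements of \<open>S\<close> congruent modulo
    \<open>uS\<close> to an element of \<open>P\<close>. It omits zero because \<open>S\<close>
    avoids \<open>V\<close>, and it is closed under products because \<open>u\<close> is prime in
    \<open>B\<close>.\<close>
  define W where "W = {b \<oplus> u \<otimes> s | b s. b \<in> P \<and> s \<in> S}"
  have PV: "u \<otimes> x \<in> P" if "x \<in> V" for x
    using that m_lcancel[OF u0 uR _ BR] unfolding V_def P_def by auto
  have PW: "b \<in> W" if "b \<in> P" for b
  proof -
    have "b = b \<oplus> u \<otimes> \<zero>" using that BR uR unfolding P_def by simp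
    then show ?thesis unfolding W_def using that subringE(2)[OF S(1)] by blast
  qed
  have WS: "W \<subseteq> S"
  proof
    fix w assume "w \<in> W"
    then obtain b s where "w = b \<oplus> u \<otimes> s" "b \<in> S" "s \<in> S"
      unfolding W_def P_def using S(2) by blast
    then show "w \<in> S" using subringE(6)[OF S(1) uS] subringE(7)[OF S(1)] by simp
  qed
  have integ: "y \<in> S" if y: "y \<in> carrier R" and c: "c \<in> P" "c \<otimes> y [^] k \<in> poly_values B y k" for y c k
  proof (rule integral_over_max_subring[OF S(1,4) _ _ _ uS _ _ y PW[OF c(1)]])
    show "W \<subseteq> S" by (rule WS)
    show "\<zero> \<notin> W"
    proof
      assume "\<zero> \<in> W"
      then obtain b s where bs: "\<zero> = b \<oplus> u \<otimes> s" "b \<in> P" "s \<in> S" unfolding W_def by blast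
      have R: "b \<in> carrier R" "s \<in> carrier R" using bs BR SR unfolding P_def by auto
      have "b = (b \<oplus> u \<otimes> s) \<oplus> u \<otimes> (\<ominus> s)" using R uR by algebra
      then have b: "b = u \<otimes> (\<ominus> s)" unfolding bs(1)[symmetric] using R uR by simp
      then have "\<ominus> s \<in> V" using bs(2) R unfolding V_def P_def by auto
      then show False using S(3) subringE(5)[OF S(1) bs(3)] by blast
    qed
    show "v \<otimes> w \<in> W" if vw: "v \<in> W" "w \<in> W" for v w
    proof -
      obtain b s where bs: "v = b \<oplus> u \<otimes> s" "b \<in> P" "s \<in> S" using vw(1) unfolding W_def by blast
      obtain b' s' where bs': "w = b' \<oplus> u \<otimes> s'" "b' \<in> P" "s' \<in> S" using vw(2) unfolding W_def by blast
      have R: "b \<in> carrier R" "s \<in> carrier R" "b' \<in> carrier R" "s' \<in> carrier R"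
        using bs bs' BR SR unfolding P_def by auto
      have "v \<otimes> w = b \<otimes> b' \<oplus> u \<otimes> (b \<otimes> s' \<oplus> s \<otimes> w)"
        using bs(1) bs'(1) R uR by algebra
      moreover have "b \<otimes> b' \<in> P" using prime bs(2) bs'(2) subringE(6)[OF B] unfolding P_def by blast
      moreover have "b \<otimes> s' \<oplus> s \<otimes> w \<in> S"
        using bs(2,3) bs'(3) vw(2) S(2) WS unfolding P_def
        by (intro subringE(6)[OF S(1)] subringE(7)[OF S(1)]) auto
      ultimately show ?thesis unfolding W_def by blast
    qed
    show "w \<ominus> u \<otimes> s \<in> W" if ws: "w \<in> W" "s \<in> S" for w s
    proof -
      obtain b s' where bs: "w = b \<oplus> u \<otimes> s'" "b \<in> P" "s' \<in> S" using ws(1) unfolding W_def by blast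
      have R: "b \<in> carrier R" "s \<in> carrier R" "s' \<in> carrier R"
        using bs ws BR SR unfolding P_def by auto
      have "w \<ominus> u \<otimes> s = b \<oplus> u \<otimes> (s' \<ominus> s)" using bs(1) R uR by algebra
      moreover have "s' \<ominus> s \<in> S"
        by (rule subring_minus[OF S(1) bs(3) ws(2)])
      ultimately show ?thesis unfolding W_def using bs(2) by blast
    qed
    show "u \<otimes> x \<in> W" if "x \<in> V" for x using PW[OF PV[OF that]] .
    show "c \<otimes> y [^] k \<in> poly_values S y k" using c(2) poly_values_base_mono[OF S(2)] by blast
  qed
  have "inv u \<notin> S"
  proof
    assume i: "inv u \<in> S"
    have "inv u \<notin> B"
    proof
      assume "inv u \<in> B"
      moreover have "\<one> = u \<otimes> inv u" using u by simp
      ultimately show False using one by blast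
    qed
    then have "inv u \<in> V" unfolding V_def using u subringE(3)[OF B] by simp
    then show False using S(3) i by blast
  qed
  moreover have "\<exists>n::nat. u [^] n \<otimes> y \<in> S" if y: "y \<in> carrier R" for y
  proof -
    obtain k c where c: "c \<in> B" "c \<noteq> \<zero>" "c \<otimes> y [^] k \<in> poly_values B y k"
      using alg[OF y] unfolding algebraic_over_def by blast
    \<comment> \<open>Separatedness provides the exact power of \<open>u\<close> dividing the
      nonzero \<open>c\<close>, so that the cofactor \<open>d\<close> lies in
      \<open>P\<close>.\<close>
    have "\<exists>n::nat. c \<in> (\<otimes>) (u [^] n) ` B \<and> c \<notin> (\<otimes>) (u [^] Suc n) ` B"
    proof (rule ccontr)
      assume no: "\<nexists>n::nat. c \<in> (\<otimes>) (u [^] n) ` B \<and> c \<notin> (\<otimes>) (u [^] Suc n) ` B"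
      have "c \<in> (\<otimes>) (u [^] n) ` B" for n :: nat
      proof (induction n)
        case 0
        show ?case using c(1) BR by (intro image_eqI[of _ _ c]) auto
      next
        case (Suc n)
        then show ?case using no by blast
      qed
      then show False using sep[OF c(1)] c(2) by blast
    qed
    then obtain n :: nat where n: "c \<in> (\<otimes>) (u [^] n) ` B" "c \<notin> (\<otimes>) (u [^] Suc n) ` B"
      by blast
    then obtain d where d: "d \<in> B" "c = u [^] n \<otimes> d" by blast
    have "d \<notin> (\<otimes>) u ` B"
    proof
      assume "d \<in> (\<otimes>) u ` B"
      then obtain e where "e \<in> B" "d = u \<otimes> e" by blast
      then show False using n(2) d(2) uR BR by (auto simp: m_assoc)
    qed
    then have dP: "d \<in> P" using d unfolding P_def by blast
    have un: "u [^] n \<in> B" using uB subringE(3,6)[OF B] by (induction n) auto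
    define v where "v = u [^] n"
    have vR: "v \<in> carrier R" unfolding v_def using uR by simp
    have k: "k \<noteq> 0" using c BR y by (cases k) auto
    then obtain j where j: "k = Suc j" using not0_implies_Suc by blast
    \<comment> \<open>Since \<open>c = v d\<close> and \<open>k = j + 1\<close>, multiplying the
      relation by \<open>v [^] j\<close> turns its leading term into
      \<open>d (v y) [^] k\<close>.\<close>
    have "v [^] j \<otimes> (c \<otimes> y [^] k) \<in> poly_values B (v \<otimes> y) k"
      using poly_values_scale[OF B y un c(3), of j] j unfolding v_def by simp
    moreover have "v [^] j \<otimes> (c \<otimes> y [^] k) = d \<otimes> (v \<otimes> y) [^] k"
      using d vR y BR[OF d(1)] unfolding j v_def[symmetric]
      by (simp add: nat_pow_distrib m_ac)
    ultimately have "v \<otimes> y \<in> S" using integ[OF _ dP, of "v \<otimes> y" k] vR y by simp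
    then show ?thesis unfolding v_def by blast
  qed
  ultimately show thesis using that S(1) uS by blast
qed

theorem (in domain) gauss_subring_imp_submaximal:
  assumes "gauss_subring u B" "u \<in> Units R"
  shows "submaximal R"
proof -
  have uR: "u \<in> carrier R" and u0: "u \<noteq> \<zero>"
    using assms(2) Units_nonzero by auto
  obtain B' where B': "gauss_subring u B'" "\<And>y. y \<in> carrier R \<Longrightarrow> algebraic_over B' y"
    using gauss_subring_algebraic[OF assms(1) u0] by blast
  obtain S where S: "subring S R" "u \<in> S" "inv u \<notin> S"
    "\<And>y. y \<in> carrier R \<Longrightarrow> \<exists>n::nat. u [^] n \<otimes> y \<in> S"
    using gauss_subring_dominating[OF B' assms(2)] by blast
  obtain M where M: "subring M R" "S \<subseteq> M" "M \<inter> {inv u} = {}"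
    "\<And>N. subring N R \<Longrightarrow> M \<subset> N \<Longrightarrow> N \<inter> {inv u} \<noteq> {}"
    using subring_avoiding_maximal[OF S(1), of "{inv u}"] S(3) by auto
  \<comment> \<open>A strictly larger \<open>N\<close> contains the inverse of \<open>u\<close>, and
    every \<open>y\<close> is a power of that inverse times an element of \<open>S\<close>.\<close>
  have "N = carrier R" if N: "subring N R" "M \<subset> N" for N
  proof
    show "N \<subseteq> carrier R" using subringE(1)[OF N(1)] .
    show "carrier R \<subseteq> N"
    proof
      fix y assume y: "y \<in> carrier R"
      then obtain n :: nat where n: "u [^] n \<otimes> y \<in> S" using S(4) by blast
      have i: "inv u \<in> N" using M(4)[OF N] by blast
      then have "inv u [^] n \<in> N" using subringE(3,6)[OF N(1)] by (induction n) auto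
      then have "inv u [^] n \<otimes> (u [^] n \<otimes> y) \<in> N"
        using n M(2) N(2) subringE(6)[OF N(1)] by blast
      moreover have "inv u [^] n \<otimes> (u [^] n \<otimes> y) = y"
      proof -
        have "inv u [^] n \<otimes> (u [^] n \<otimes> y) = (inv u \<otimes> u) [^] n \<otimes> y"
          using y uR assms(2) by (simp only: nat_pow_distrib Units_inv_closed m_assoc nat_pow_closed)
        then show ?thesis using y assms(2) by simp
      qed
      ultimately show "y \<in> N" by simp
    qed
  qed
  moreover have "M \<subset> carrier R" using subringE(1)[OF M(1)] M(3) assms(2) by auto
  ultimately have "maximal_subring M R" using M(1) unfolding maximal_subring_def by blast
  then show ?thesis unfolding submaximal_def by blast
qed

section \<open>Units outside the integral closure of the prime subring\<close>

definition (in ring) int_elem :: "int \<Rightarrow> 'a" where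
  "int_elem n = add_pow R n \<one>"

definition (in ring) prime_subring :: "'a set" where
  "prime_subring = range int_elem"

context ring
begin

lemma int_elem_closed [simp]: "int_elem n \<in> carrier R"
  unfolding int_elem_def by simp

lemma int_elem_add: "int_elem (m + n) = int_elem m \<oplus> int_elem n"
  unfolding int_elem_def by (simp add: add.int_pow_mult)

lemma int_elem_minus: "int_elem (- n) = \<ominus> int_elem n"
  unfolding int_elem_def by (simp add: add.int_pow_neg)

lemma int_elem_mult: "int_elem (m * n) = int_elem m \<otimes> int_elem n"
  unfolding int_elem_def
  using add_pow_ldistr_int[of \<one> "add_pow R n \<one>" m] add.int_pow_pow[of \<one> m n]
  by (simp add: mult.commute)

lemma int_elem_0 [simp]: "int_elem 0 = \<zero>"
  unfolding int_elem_def add_pow_def by simp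

lemma int_elem_1 [simp]: "int_elem 1 = \<one>"
  unfolding int_elem_def by simp

lemma int_elem_pow: "(int_elem m) [^] (n::nat) = int_elem (m ^ n)"
  by (induction n) (simp_all add: int_elem_mult[symmetric] mult.commute)

lemma prime_subring_is_subring: "subring prime_subring R"
  by (rule subringI)
    (auto simp: prime_subring_def simp flip: int_elem_add int_elem_minus int_elem_mult
      intro: range_eqI[of _ _ 1])

lemma prime_subring_subset:
  assumes "subring Q R" shows "prime_subring \<subseteq> Q"
proof -
  have nat: "int_elem (int n) \<in> Q" for n
    by (induction n) (use subringE(2,3,7)[OF assms] in \<open>auto simp: int_elem_add\<close>)
  have "int_elem n \<in> Q" for n :: int
  proof (cases "n \<ge> 0")
    case True
    then show ?thesis using nat[of "nat n"] by simp
  next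
    case False
    then show ?thesis
      using subringE(5)[OF assms nat[of "nat (- n)"]] int_elem_minus[of "- n"] by simp
  qed
  then show ?thesis unfolding prime_subring_def by blast
qed

lemma adjoin_subset:
  assumes Q: "subring Q R" and "B \<subseteq> Q" "y \<in> Q"
  shows "adjoin B y \<subseteq> Q"
proof -
  have "t \<in> Q" if "t \<in> poly_values B y k" for t k
    using that
  proof (induction k arbitrary: t)
    case (Suc k)
    then obtain s t' where "s \<in> B" "t' \<in> poly_values B y k" "t = s \<oplus> y \<otimes> t'"
      by (metis poly_values_SucE)
    then show ?case using Suc.IH assms(2,3) subringE(6,7)[OF Q] by blast
  qed (use subringE(2)[OF Q] in simp)
  then show ?thesis unfolding adjoin_def by blast
qed

end

context domain
begin

lemma gauss_subring_prime_subring: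
  assumes char0: "\<And>n::int. int_elem n = \<zero> \<Longrightarrow> n = 0" and q: "Factorial_Ring.prime (q::int)"
  shows "gauss_subring (int_elem q) prime_subring"
proof -
  have inj: "m = n" if "int_elem m = int_elem n" for m n :: int
  proof -
    have "int_elem (m + - n) = \<zero>"
      unfolding int_elem_add int_elem_minus using that by (simp add: r_neg)
    then show ?thesis using char0 by force
  qed
  have img: "int_elem m \<in> (\<otimes>) (int_elem k) ` prime_subring \<longleftrightarrow> k dvd m" for m k :: int
    unfolding prime_subring_def image_image int_elem_mult[symmetric]
    by (auto dest: inj elim: dvdE)
  show ?thesis
    unfolding gauss_subring_def
  proof (intro conjI ballI impI prime_subring_is_subring)
    show "int_elem q \<in> prime_subring" unfolding prime_subring_def by blast
    show "\<one> \<notin> (\<otimes>) (int_elem q) ` prime_subring"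
      using img[of 1 q] q by (auto simp: not_prime_unit)
  next
    fix a b assume "a \<in> prime_subring" "b \<in> prime_subring"
      and ab: "a \<otimes> b \<in> (\<otimes>) (int_elem q) ` prime_subring"
    then obtain m n :: int where mn: "a = int_elem m" "b = int_elem n" unfolding prime_subring_def by blast
    then have "q dvd m * n" using ab img[of "m * n" q] by (simp add: int_elem_mult)
    then show "a \<in> (\<otimes>) (int_elem q) ` prime_subring \<or> b \<in> (\<otimes>) (int_elem q) ` prime_subring"
      using prime_dvd_mult_iff[OF q] mn img by blast
  next
    fix b assume "b \<in> prime_subring"
      and div: "\<forall>n::nat. b \<in> (\<otimes>) ((int_elem q) [^] n) ` prime_subring"
    then obtain m :: int where m: "b = int_elem m" unfolding prime_subring_def by blast
    have d: "q ^ n dvd m" for n using div[rule_format, of n] m img by (simp add: int_elem_pow)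
    have "m = 0"
    proof (rule ccontr)
      assume m0: "m \<noteq> 0"
      \<comment> \<open>Divisibility by all powers of \<open>q\<close> is tested at the exponent
        \<open>\<bar>m\<bar>\<close>, where already the power of \<open>2\<close> exceeds
        \<open>\<bar>m\<bar>\<close>.\<close>
      then have "q ^ nat \<bar>m\<bar> \<le> \<bar>m\<bar>" using d dvd_imp_le_int by (metis abs_le_iff)
      moreover have "\<bar>m\<bar> < 2 ^ nat \<bar>m\<bar>" using of_nat_less_two_power[of "nat \<bar>m\<bar>", where 'a=int] by simp
      moreover have "(2::int) ^ nat \<bar>m\<bar> \<le> q ^ nat \<bar>m\<bar>" using prime_ge_2_int[OF q] by (intro power_mono) auto
      ultimately show False by linarith
    qed
    then show "b = \<zero>" using m by simp
  qed
qed

text \<open>Here \<open>adjoin B u\<close> is a polynomial ring in \<open>u\<close> over the domain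
  \<open>B\<close>: being divisible by \<open>u\<close> means having constant term zero, which makes
  \<open>u\<close> prime, and only zero is divisible by all powers of \<open>u\<close>.\<close>

lemma gauss_subring_transcendental:
  assumes B: "subring B R" and u: "u \<in> carrier R" and trans: "\<not> algebraic_over B u"
  shows "gauss_subring u (adjoin B u)"
proof -
  let ?A = "adjoin B u"
  note A = adjoin_subring[OF B u]
  note uniq = poly_values_unique2[OF B u trans]
  note cl = base_closed[OF B u] poly_values_closed[OF B u]
  have u0: "u \<noteq> \<zero>"
  proof
    assume "u = \<zero>"
    then have "\<one> \<otimes> u [^] Suc 0 \<in> poly_values B u (Suc 0)" using poly_values_zero[OF B u] by simp
    then show False using trans subringE(3)[OF B] one_not_zero unfolding algebraic_over_def by blast
  qed
  have AR: "c \<in> carrier R" if "c \<in> ?A" for c using that subringE(1)[OF A] by blast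
  have const: "s = \<zero>" if st: "s \<in> B" "t \<in> poly_values B u k" "s \<oplus> u \<otimes> t = u \<otimes> c" "c \<in> ?A" for s t k c
  proof -
    obtain l where l: "c \<in> poly_values B u l" using st(4) unfolding adjoin_def by blast
    have "s \<oplus> u \<otimes> t = \<zero> \<oplus> u \<otimes> c" using st(3,4) AR u by simp
    then show ?thesis using uniq[OF st(1) subringE(2)[OF B] st(2) l] by blast
  qed
  show ?thesis
    unfolding gauss_subring_def
  proof (intro conjI ballI impI A adjoin_gen[OF B u])
    show "\<one> \<notin> (\<otimes>) u ` ?A"
    proof
      assume "\<one> \<in> (\<otimes>) u ` ?A"
      then obtain c where c: "c \<in> ?A" "\<one> = u \<otimes> c" by blast
      have "\<one> \<oplus> u \<otimes> \<zero> = \<one>" using u by simp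
      then have "\<one> \<oplus> u \<otimes> \<zero> = u \<otimes> c" using c(2) by simp
      then show False
        using const[OF subringE(3)[OF B] poly_values_zero[OF B u] _ c(1)] one_not_zero by blast
    qed
  next
    fix a b assume a: "a \<in> ?A" and b: "b \<in> ?A" and ab: "a \<otimes> b \<in> (\<otimes>) u ` ?A"
    obtain k a0 a1 where a': "a0 \<in> B" "a1 \<in> poly_values B u k" "a = a0 \<oplus> u \<otimes> a1"
      using adjoinE[OF B u a] by metis
    obtain l b0 b1 where b': "b0 \<in> B" "b1 \<in> poly_values B u l" "b = b0 \<oplus> u \<otimes> b1"
      using adjoinE[OF B u b] by metis
    obtain c where c: "c \<in> ?A" "a \<otimes> b = u \<otimes> c" using ab by blast
    note cls = cl(1)[OF a'(1)] cl(2)[OF a'(2)] cl(1)[OF b'(1)] cl(2)[OF b'(2)] u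
    have A': "a0 \<in> ?A" "a1 \<in> ?A" "b1 \<in> ?A"
      using a' b' adjoin_base[OF B u] unfolding adjoin_def by blast+
    then have "a0 \<otimes> b1 \<oplus> a1 \<otimes> b \<in> ?A" using b subringE(6,7)[OF A] by blast
    then obtain j where j: "a0 \<otimes> b1 \<oplus> a1 \<otimes> b \<in> poly_values B u j" unfolding adjoin_def by blast
    have "a0 \<otimes> b0 \<oplus> u \<otimes> (a0 \<otimes> b1 \<oplus> a1 \<otimes> b) = u \<otimes> c"
      using c(2) cls AR[OF c(1)] a'(3) b'(3) by algebra
    then have "a0 \<otimes> b0 = \<zero>"
      using const[OF subringE(6)[OF B a'(1) b'(1)] j _ c(1)] by blast
    then have "a0 = \<zero> \<or> b0 = \<zero>" using cls integral by blast
    then have "a = u \<otimes> a1 \<or> b = u \<otimes> b1" using a'(3) b'(3) cls by auto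
    then show "a \<in> (\<otimes>) u ` ?A \<or> b \<in> (\<otimes>) u ` ?A" using A' by blast
  next
    fix b assume b: "b \<in> ?A" "\<forall>n::nat. b \<in> (\<otimes>) (u [^] n) ` ?A"
    have "t = \<zero>" if "t \<in> poly_values B u k" "\<And>n::nat. t \<in> (\<otimes>) (u [^] n) ` ?A" for t k
      using that
    proof (induction k arbitrary: t)
      case (Suc k)
      obtain s t' where t: "s \<in> B" "t' \<in> poly_values B u k" "t = s \<oplus> u \<otimes> t'"
        using poly_values_SucE[OF Suc.prems(1)] by metis
      obtain c where c: "c \<in> ?A" "t = u [^] Suc 0 \<otimes> c" using Suc.prems(2)[of "Suc 0"] by blast
      have "s = \<zero>" using const[OF t(1,2) _ c(1)] c(2) t(3) u by simp
      then have t': "t = u \<otimes> t'" using t cl u by simp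
      \<comment> \<open>Cancelling one \<open>u\<close> turns divisibility of \<open>t\<close> by
        \<open>u [^] Suc n\<close> into divisibility of the shorter \<open>t'\<close> by
        \<open>u [^] n\<close>.\<close>
      have "t' \<in> (\<otimes>) (u [^] n) ` ?A" for n :: nat
      proof -
        obtain d where d: "d \<in> ?A" "t = u [^] Suc n \<otimes> d" using Suc.prems(2)[of "Suc n"] by blast
        have "u \<otimes> t' = u \<otimes> (u [^] n \<otimes> d)" using d(2) AR[OF d(1)] u t' by (simp add: m_ac)
        then have "t' = u [^] n \<otimes> d"
          using m_lcancel[OF u0 u] cl(2)[OF t(2)] AR[OF d(1)] u by simp
        then show ?thesis using d(1) by blast
      qed
      then have "t' = \<zero>" using Suc.IH[OF t(2)] by blast
      then show ?case using t' u by simp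
    qed simp
    then show "b = \<zero>" using b unfolding adjoin_def by blast
  qed
qed

section \<open>Criteria for a domain to be submaximal\<close>

lemma transcendental_unit_imp_submaximal:
  assumes "u \<in> Units R" "subring B R" "\<not> algebraic_over B u"
  shows "submaximal R"
  using gauss_subring_imp_submaximal[OF gauss_subring_transcendental] assms by blast

lemma prime_unit_imp_submaximal:
  assumes "\<And>n::int. int_elem n = \<zero> \<Longrightarrow> n = 0" "Factorial_Ring.prime (q::int)" "int_elem q \<in> Units R"
  shows "submaximal R"
  using gauss_subring_imp_submaximal[OF gauss_subring_prime_subring] assms by blast

text \<open>Cancelling powers of \<open>a\<close> in an algebraic relation leads to one with nonzero
  constant term, and that constant term is \<open>a\<close> times an element of
  \<open>adjoin B a\<close>.\<close>

lemma algebraic_over_constant_multiple: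
  assumes B: "subring B R" and a: "a \<in> carrier R" "a \<noteq> \<zero>" and alg: "algebraic_over B a"
  obtains s t where "s \<in> B" "s \<noteq> \<zero>" "t \<in> adjoin B a" "s = a \<otimes> t"
proof -
  have "\<exists>s t. s \<in> B \<and> s \<noteq> \<zero> \<and> t \<in> adjoin B a \<and> s = a \<otimes> t"
    if "c \<in> B" "c \<noteq> \<zero>" "c \<otimes> a [^] k \<in> poly_values B a k" for c and k :: nat
    using that(3)
  proof (induction k)
    case 0
    then show ?case using that(1,2) base_closed[OF B a(1)] by simp
  next
    case (Suc k)
    obtain s t where st: "s \<in> B" "t \<in> poly_values B a k" "c \<otimes> a [^] Suc k = s \<oplus> a \<otimes> t"
      using poly_values_SucE[OF Suc.prems] by metis
    note cl = base_closed[OF B a(1) that(1)] base_closed[OF B a(1) st(1)]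
      poly_values_closed[OF B a(1) st(2)]
    have p: "a [^] k \<in> carrier R" using a by simp
    have eq: "a \<otimes> (c \<otimes> a [^] k) = s \<oplus> a \<otimes> t" using st(3) cl a by (simp add: m_ac)
    show ?case
    proof (cases "s = \<zero>")
      case True
      then have "a \<otimes> (c \<otimes> a [^] k) = a \<otimes> t" using eq cl a by simp
      then have "c \<otimes> a [^] k = t" using m_lcancel[OF a(2,1)] cl p by simp
      then show ?thesis using Suc.IH st(2) by simp
    next
      case False
      have "a \<otimes> (c \<otimes> a [^] k \<ominus> t) = (s \<oplus> a \<otimes> t) \<ominus> a \<otimes> t"
        unfolding eq[symmetric] using cl a p by algebra
      then have "s = a \<otimes> (c \<otimes> a [^] k \<ominus> t)" using cl a by (simp add: a_minus_def a_assoc r_neg)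
      moreover have "c \<otimes> a [^] k \<ominus> t \<in> adjoin B a"
      proof -
        note A = adjoin_subring[OF B a(1)]
        have "a [^] k \<in> adjoin B a"
          using adjoin_gen[OF B a(1)] subringE(3,6)[OF A] by (induction k) auto
        moreover have "c \<in> adjoin B a" "t \<in> adjoin B a"
          using that(1) st(2) adjoin_base[OF B a(1)] unfolding adjoin_def by blast+
        ultimately show ?thesis unfolding a_minus_def using subringE(5,6,7)[OF A] by blast
      qed
      ultimately show ?thesis using st(1) False by blast
    qed
  qed
  then show thesis using alg that unfolding algebraic_over_def by blast
qed

text \<open>Substituting \<open>\<one> \<oplus> a\<close> into a polynomial preserves its degree and
  its leading coefficient.\<close>

lemma algebraic_over_one_plus:
  assumes B: "subring B R" and a: "a \<in> carrier R" and alg: "algebraic_over B (\<one> \<oplus> a)"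
  shows "algebraic_over B a"
proof -
  let ?u = "\<one> \<oplus> a"
  have sub: "t \<in> poly_values B a k" if "t \<in> poly_values B ?u k" for t k
    using that
  proof (induction k arbitrary: t)
    case (Suc k)
    obtain s t' where t: "s \<in> B" "t' \<in> poly_values B ?u k" "t = s \<oplus> ?u \<otimes> t'"
      using poly_values_SucE[OF Suc.prems] by metis
    have t': "t' \<in> poly_values B a k" using Suc.IH[OF t(2)] .
    have "t = (s \<oplus> a \<otimes> t') \<oplus> t'"
      using t(3) base_closed[OF B a t(1)] poly_values_closed[OF B a t'] a by algebra
    then show ?case
      using poly_values_add[OF B a poly_values_SucI[OF t(1) t'] poly_values_Suc_mono[OF B a t']] by simp
  qed simp
  have pow: "\<exists>r\<in>poly_values B a k. ?u [^] k = a [^] k \<oplus> r" for k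
  proof (induction k)
    case 0
    then show ?case by simp
  next
    case (Suc k)
    then obtain r where r: "r \<in> poly_values B a k" "?u [^] k = a [^] k \<oplus> r" by blast
    have rR: "r \<in> carrier R" and p: "a [^] k \<in> carrier R" using poly_values_closed[OF B a r(1)] a by auto
    have "?u [^] Suc k = (a [^] k \<oplus> r) \<otimes> (\<one> \<oplus> a)" using r(2) by simp
    also have "\<dots> = a [^] k \<otimes> a \<oplus> ((r \<oplus> \<one> \<otimes> a [^] k) \<oplus> a \<otimes> r)" using rR p a by algebra
    finally have "?u [^] Suc k = a [^] Suc k \<oplus> ((r \<oplus> \<one> \<otimes> a [^] k) \<oplus> a \<otimes> r)" by simp
    moreover have "(r \<oplus> \<one> \<otimes> a [^] k) \<oplus> a \<otimes> r \<in> poly_values B a (Suc k)"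
      by (intro poly_values_add[OF B a] poly_values_top[OF B a] poly_values_shift[OF B a]
          r(1) subringE(3)[OF B])
    ultimately show ?case by blast
  qed
  obtain k c where c: "c \<in> B" "c \<noteq> \<zero>" "c \<otimes> ?u [^] k \<in> poly_values B ?u k"
    using alg unfolding algebraic_over_def by blast
  obtain r where r: "r \<in> poly_values B a k" "?u [^] k = a [^] k \<oplus> r" using pow by blast
  have cl: "r \<in> carrier R" "a [^] k \<in> carrier R" "c \<in> carrier R"
    using poly_values_closed[OF B a r(1)] a base_closed[OF B a c(1)] by auto
  have "c \<otimes> a [^] k = c \<otimes> ?u [^] k \<oplus> \<ominus> (c \<otimes> r)" unfolding r(2) using cl by algebra
  then have "c \<otimes> a [^] k \<in> poly_values B a k"
    using poly_values_add[OF B a sub[OF c(3)] poly_values_minus[OF B a poly_values_smult[OF B a c(1) r(1)]]]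
    by simp
  then show ?thesis using c unfolding algebraic_over_def by blast
qed

text \<open>In positive characteristic the prime subring is a finite field. With \<open>p\<close>
  the least positive integer that vanishes, a proper common divisor of \<open>N\<close> and
  \<open>p\<close> would yield a smaller one, so Bezout's identity supplies the inverse.\<close>

lemma int_elem_invertible:
  assumes n: "n \<noteq> 0" "int_elem n = \<zero>" and N: "int_elem N \<noteq> \<zero>"
  obtains M :: int where "int_elem N \<otimes> int_elem M = \<one>"
proof -
  let ?P = "\<lambda>p::nat. p > 0 \<and> int_elem (int p) = \<zero>"
  define p where "p = (LEAST p. ?P p)"
  have "int_elem (\<bar>n\<bar>) = \<zero>" using n(2) int_elem_minus[of n] by (cases "n \<ge> 0") auto
  then have "?P (nat \<bar>n\<bar>)" using n(1) by simp
  then have p: "?P p" unfolding p_def by (rule LeastI)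
  have p_min: "p \<le> r" if "?P r" for r unfolding p_def using that by (rule Least_le)
  define d where "d = gcd N (int p)"
  obtain x y where xy: "x * N + y * int p = d" unfolding d_def using bezout_int by blast
  have "int_elem (y * int p) = \<zero>" using p by (simp add: int_elem_mult)
  then have d: "int_elem d = int_elem x \<otimes> int_elem N"
    unfolding xy[symmetric] int_elem_add by (simp add: int_elem_mult)
  obtain e where e: "int p = d * e" unfolding d_def by (meson gcd_dvd2 dvdE)
  have d_pos: "d > 0" unfolding d_def using p by (simp add: gcd_pos_int)
  then have e_pos: "e > 0" using e p by (metis of_nat_0_less_iff zero_less_mult_pos)
  obtain f where f: "N = d * f" unfolding d_def by (meson gcd_dvd1 dvdE)
  have "int_elem d \<noteq> \<zero>" using N unfolding f int_elem_mult by auto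
  moreover have "int_elem d \<otimes> int_elem e = \<zero>" using p e by (simp add: int_elem_mult[symmetric])
  ultimately have "int_elem e = \<zero>" using integral[of "int_elem d" "int_elem e"] by simp
  then have "int p \<le> e" using p_min[of "nat e"] e_pos by auto
  then have "d = 1" using e e_pos d_pos by (simp add: mult_le_cancel_right1)
  then have "int_elem N \<otimes> int_elem x = \<one>" using d by (simp add: m_comm)
  then show thesis using that by blast
qed

text \<open>If \<open>a\<close> is transcendental over the prime subring, then so is the unit
  \<open>\<one> \<oplus> a\<close>. Otherwise some nonzero integer \<open>N\<close> is a multiple of
  \<open>a\<close> in \<open>Q\<close>, so \<open>1 + N k\<close> is a unit for every integer
  \<open>k\<close>. In characteristic 0 a prime factor of \<open>1 + 3N\<close> is then a unit; in
  positive characteristic, subtracting \<open>N\<close> times its inverse from 1 would make zero a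
  unit.\<close>

lemma submaximal_of_quasi_radical:
  assumes Q: "subring Q R" and a: "a \<in> Q" "a \<noteq> \<zero>"
    and units: "\<And>t. t \<in> Q \<Longrightarrow> \<one> \<oplus> a \<otimes> t \<in> Units R"
  shows "submaximal R"
proof (cases "algebraic_over prime_subring a")
  case False
  have aR: "a \<in> carrier R" using a(1) subringE(1)[OF Q] by blast
  have "\<one> \<oplus> a \<in> Units R" using units[OF subringE(3)[OF Q]] aR by simp
  then show ?thesis
    using transcendental_unit_imp_submaximal[OF _ prime_subring_is_subring]
      algebraic_over_one_plus[OF prime_subring_is_subring aR] False by blast
next
  case True
  have aR: "a \<in> carrier R" using a(1) subringE(1)[OF Q] by blast
  obtain s t where st: "s \<in> prime_subring" "s \<noteq> \<zero>" "t \<in> adjoin prime_subring a" "s = a \<otimes> t"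
    using algebraic_over_constant_multiple[OF prime_subring_is_subring aR a(2) True] by blast
  have tQ: "t \<in> Q" using adjoin_subset[OF Q prime_subring_subset[OF Q] a(1)] st(3) by blast
  have tR: "t \<in> carrier R" using tQ subringE(1)[OF Q] by blast
  have ZQ: "int_elem n \<in> Q" for n using prime_subring_subset[OF Q] unfolding prime_subring_def by blast
  obtain N :: int where N: "s = int_elem N" using st(1) unfolding prime_subring_def by blast
  show ?thesis
  proof (cases "\<forall>n::int. int_elem n = \<zero> \<longrightarrow> n = 0")
    case True
    \<comment> \<open>\<open>1 + 3N\<close> is never \<open>0\<close>, \<open>1\<close> or \<open>-1\<close> for \<open>N \<noteq> 0\<close>.\<close>
    have N0: "N \<noteq> 0" using N st(2) by auto
    have N1: "1 + N * 3 \<noteq> 0" by presburger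
    from N0 have "\<not> is_unit (1 + N * 3)" by (auto simp: zdvd1_eq)
    then obtain q where q: "Factorial_Ring.prime q" "q dvd 1 + N * 3"
      using prime_divisor_exists[of "1 + N * 3"] N1 by auto
    then obtain z where z: "1 + N * 3 = q * z" by blast
    have "int_elem q \<otimes> int_elem z = \<one> \<oplus> a \<otimes> (t \<otimes> int_elem 3)"
      unfolding int_elem_mult[symmetric] z[symmetric]
      using st(4) N aR tR by (simp add: int_elem_add int_elem_mult m_assoc)
    also have "\<dots> \<in> Units R" using units subringE(6)[OF Q tQ ZQ] by blast
    finally have "int_elem q \<in> Units R" by (rule unit_factor) auto
    then show ?thesis using prime_unit_imp_submaximal[OF _ q(1)] True by blast
  next
    case False
    then obtain n :: int where "n \<noteq> 0" "int_elem n = \<zero>" by blast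
    then obtain M :: int where M: "int_elem N \<otimes> int_elem M = \<one>"
      using int_elem_invertible st(2) N by blast
    have "\<ominus> (t \<otimes> int_elem M) \<in> Q" using subringE(5,6)[OF Q] tQ ZQ by blast
    then have "\<one> \<oplus> a \<otimes> (\<ominus> (t \<otimes> int_elem M)) \<in> Units R" using units by blast
    moreover have "\<one> \<oplus> a \<otimes> (\<ominus> (t \<otimes> int_elem M)) = \<zero>"
    proof -
      have "a \<otimes> (t \<otimes> int_elem M) = s \<otimes> int_elem M" using st(4) aR tR by (simp add: m_assoc)
      also have "\<dots> = \<one>" using M N by simp
      finally have "a \<otimes> (t \<otimes> int_elem M) = \<one>" .
      then show ?thesis using aR tR by (simp add: r_minus r_neg)
    qed
    ultimately show ?thesis using Units_nonzero by auto
  qed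
qed

end

section \<open>Reduction to domains and fields\<close>

lemma (in cring) ideal_avoiding_maximal:
  assumes "ideal I R" "I \<inter> V = {}"
  obtains J where "ideal J R" "I \<subseteq> J" "J \<inter> V = {}"
    "\<And>K. ideal K R \<Longrightarrow> J \<subset> K \<Longrightarrow> K \<inter> V \<noteq> {}"
proof -
  let ?A = "{J. ideal J R \<and> I \<subseteq> J \<and> J \<inter> V = {}}"
  have "\<exists>M\<in>?A. \<forall>N\<in>?A. M \<subseteq> N \<longrightarrow> N = M"
  proof (rule subset_Zorn_nonempty)
    show "?A \<noteq> {}" using assms by blast
    fix C assume C: "C \<noteq> {}" "subset.chain ?A C"
    have id: "ideal J R" if "J \<in> C" for J using that C(2) unfolding subset.chain_def by blast
    have "ideal (\<Union>C) R"
    proof (rule idealI[OF ring_axioms], rule add.subgroupI)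
      show "\<Union>C \<subseteq> carrier R" using id ideal.Icarr by fastforce
      show "\<Union>C \<noteq> {}" using C(1) id additive_subgroup.zero_closed[OF ideal.axioms(1)] by blast
      fix a assume "a \<in> \<Union>C"
      then obtain J where J: "J \<in> C" "a \<in> J" by blast
      interpret J: ideal J R by (rule id[OF J(1)])
      show "\<ominus> a \<in> \<Union>C" by (rule UnionI[OF J(1) J.a_inv_closed[OF J(2)]])
      show "x \<otimes> a \<in> \<Union>C" "a \<otimes> x \<in> \<Union>C" if "x \<in> carrier R" for x
        by (rule UnionI[OF J(1) J.I_l_closed[OF J(2) that]], rule UnionI[OF J(1) J.I_r_closed[OF J(2) that]])
      fix b assume "b \<in> \<Union>C"
      then obtain L where L: "L \<in> C" "b \<in> L" by blast
      have "J \<subseteq> L \<or> L \<subseteq> J" using C(2) J(1) L(1) unfolding subset.chain_def by blast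
      then obtain K where K: "K \<in> C" "a \<in> K" "b \<in> K" using J L by blast
      interpret K: ideal K R by (rule id[OF K(1)])
      show "a \<oplus> b \<in> \<Union>C" by (rule UnionI[OF K(1) K.a_closed[OF K(2,3)]])
    qed
    then show "\<Union>C \<in> ?A" using C by (auto simp: subset.chain_def)
  qed
  then obtain M where M: "M \<in> ?A" "\<forall>N\<in>?A. M \<subseteq> N \<longrightarrow> N = M" by blast
  show thesis by (rule that[of M]) (use M in auto)
qed

text \<open>An ideal maximal among those disjoint from the powers of \<open>a\<close> is prime: if
  \<open>x\<close> and \<open>y\<close> lie outside it, adding either one yields a power of
  \<open>a\<close>, and the product of the two powers would lie in the ideal if \<open>x y\<close>
  did.\<close>

lemma (in cring) primeideal_avoiding_powers:
  assumes a: "a \<in> carrier R" "\<And>n::nat. a [^] n \<noteq> \<zero>"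
  obtains P where "primeideal P R" "a \<notin> P"
proof -
  let ?V = "range (\<lambda>n::nat. a [^] n)"
  have "{\<zero>} \<inter> ?V = {}" using a(2)[symmetric] by auto
  then obtain P where P: "ideal P R" "P \<inter> ?V = {}"
    "\<And>K. ideal K R \<Longrightarrow> P \<subset> K \<Longrightarrow> K \<inter> ?V \<noteq> {}"
    using ideal_avoiding_maximal[OF zeroideal, of ?V] by metis
  interpret P: ideal P R by (rule P(1))
  have aP: "a \<notin> P"
    using P(2) a(1) nat_pow_0[of a] by (metis IntI empty_iff nat_pow_Suc l_one rangeI)
  have ext: "\<exists>(n::nat) p r. p \<in> P \<and> r \<in> carrier R \<and> a [^] n = p \<oplus> r \<otimes> x"
    if x: "x \<in> carrier R" "x \<notin> P" for x
  proof -
    have "ideal (P <+>\<^bsub>R\<^esub> PIdl x) R" using add_ideals[OF P(1) cgenideal_ideal[OF x(1)]] .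
    moreover have "P \<subseteq> P <+>\<^bsub>R\<^esub> PIdl x"
    proof
      fix p assume p: "p \<in> P"
      have "\<zero> \<in> PIdl x" 
        by (rule additive_subgroup.zero_closed[OF ideal.axioms(1)[OF cgenideal_ideal[OF x(1)]]])
      then have "p \<oplus> \<zero> \<in> P <+>\<^bsub>R\<^esub> PIdl x" unfolding set_add_def' using p by blast
      then show "p \<in> P <+>\<^bsub>R\<^esub> PIdl x" using P.Icarr[OF p] by simp
    qed
    moreover have "x \<in> P <+>\<^bsub>R\<^esub> PIdl x"
    proof -
      have "\<zero> \<oplus> x \<in> P <+>\<^bsub>R\<^esub> PIdl x"
        unfolding set_add_def' using P.zero_closed cgenideal_self[OF x(1)] by blast
      then show ?thesis using x(1) by simp
    qed
    ultimately have "(P <+>\<^bsub>R\<^esub> PIdl x) \<inter> ?V \<noteq> {}" using P(3) x(2) by blast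
    then show ?thesis unfolding set_add_def' cgenideal_def by auto
  qed
  have "primeideal P R"
  proof (rule primeidealI[OF P(1) is_cring])
    show "carrier R \<noteq> P" using a(1) aP by blast
    fix x y assume xy: "x \<in> carrier R" "y \<in> carrier R" "x \<otimes> y \<in> P"
    show "x \<in> P \<or> y \<in> P"
    proof (rule ccontr)
      assume "\<not> (x \<in> P \<or> y \<in> P)"
      then obtain m n :: nat and p r q s where *: "p \<in> P" "r \<in> carrier R" "a [^] m = p \<oplus> r \<otimes> x"
          "q \<in> P" "s \<in> carrier R" "a [^] n = q \<oplus> s \<otimes> y"
        using ext[OF xy(1)] ext[OF xy(2)] by blast
      have R: "p \<in> carrier R" "q \<in> carrier R" using * P.Icarr by auto
      have "a [^] (m + n) = (p \<oplus> r \<otimes> x) \<otimes> (q \<oplus> s \<otimes> y)"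
        unfolding *(3,6)[symmetric] using a(1) by (simp add: nat_pow_mult)
      also have "\<dots> = (q \<oplus> s \<otimes> y) \<otimes> p \<oplus> ((r \<otimes> x) \<otimes> q \<oplus> (r \<otimes> s) \<otimes> (x \<otimes> y))"
        using *(2,5) R xy(1,2) by algebra
      also have "\<dots> \<in> P"
        by (rule P.a_closed[OF P.I_l_closed[OF *(1)]
              P.a_closed[OF P.I_l_closed[OF *(4)] P.I_l_closed[OF xy(3)]]])
          (use *(2,5) R xy(1,2) in auto)
      finally show False using P(2) by blast
    qed
  qed
  then show thesis using aP that by blast
qed

lemma (in cring) maximalideal_exists:
  assumes "ideal I R" "\<one> \<notin> I"
  obtains M where "maximalideal M R" "I \<subseteq> M"
proof -
  obtain M where M: "ideal M R" "I \<subseteq> M" "M \<inter> {\<one>} = {}"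
    "\<And>K. ideal K R \<Longrightarrow> M \<subset> K \<Longrightarrow> K \<inter> {\<one>} \<noteq> {}"
    using ideal_avoiding_maximal[OF assms(1), of "{\<one>}"] assms(2) by auto
  have "maximalideal M R"
  proof (rule maximalidealI[OF M(1)])
    show "carrier R \<noteq> M" using M(3) by auto
    show "J = M \<or> J = carrier R" if J: "ideal J R" "M \<subseteq> J" "J \<subseteq> carrier R" for J
    proof (cases "J = M")
      case False
      then have "\<one> \<in> J" using M(4)[OF J(1)] J(2) by blast
      then show ?thesis using ideal.one_imp_carrier[OF J(1)] by blast
    qed simp
  qed
  then show thesis using M(2) that by blast
qed

lemma (in cring) jacobson_radical_units:
  assumes a: "a \<in> jacobson_radical R" and r: "r \<in> carrier R"
  shows "\<one> \<oplus> a \<otimes> r \<in> Units R"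
proof (rule ccontr)
  have aR: "a \<in> carrier R" using a unfolding jacobson_radical_def by blast
  let ?x = "\<one> \<oplus> a \<otimes> r"
  have x: "?x \<in> carrier R" using aR r by simp
  assume "?x \<notin> Units R"
  then have "\<one> \<notin> PIdl ?x"
  proof (rule contrapos_nn)
    assume "\<one> \<in> PIdl ?x"
    then obtain y where y: "y \<in> carrier R" "\<one> = y \<otimes> ?x" unfolding cgenideal_def by blast
    then have "?x \<otimes> y = \<one>" using m_comm[OF x y(1)] by simp
    then show "?x \<in> Units R" unfolding Units_def using x y(1) y(2)[symmetric] by auto
  qed
  then obtain M where M: "maximalideal M R" "PIdl ?x \<subseteq> M"
    using maximalideal_exists[OF cgenideal_ideal[OF x]] by blast
  interpret M: maximalideal M R by (rule M(1))
  have "a \<in> M" using a M(1) unfolding jacobson_radical_def by blast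
  then have "\<ominus> (a \<otimes> r) \<in> M" using r by (simp add: M.I_r_closed M.a_inv_closed)
  moreover have "?x \<in> M" using cgenideal_self[OF x] M(2) by blast
  ultimately have "?x \<oplus> \<ominus> (a \<otimes> r) \<in> M" by (rule M.a_closed[rotated])
  then have "\<one> \<in> M" using aR r by (simp add: a_assoc r_neg)
  then show False using M.one_imp_carrier M.I_notcarr by blast
qed

text \<open>The preimage of a maximal subring is maximal. Any subring above it contains the kernel,
  hence is saturated, so strict inclusions survive in the image.\<close>

lemma (in ring_hom_ring) submaximal_vimage:
  assumes surj: "h ` carrier R = carrier S" and "submaximal S"
  shows "submaximal R"
proof -
  obtain T where T: "subring T S" "T \<subset> carrier S"
    "\<nexists>T'. subring T' S \<and> T \<subset> T' \<and> T' \<subset> carrier S"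
    using assms(2) unfolding submaximal_def maximal_subring_def by auto
  let ?U = "{x \<in> carrier R. h x \<in> T}"
  have U: "subring ?U R"
    by (rule R.subringI) (use subringE[OF T(1)] in auto)
  have "maximal_subring ?U R"
    unfolding maximal_subring_def
  proof (intro conjI U notI)
    obtain t where t: "t \<in> carrier S" "t \<notin> T" using T(2) by blast
    then obtain x where "x \<in> carrier R" "h x = t" using surj by (metis imageE)
    then have "x \<in> carrier R" "x \<notin> ?U" using t by auto
    then show "?U \<subset> carrier R" by blast
    assume "\<exists>S'. subring S' R \<and> ?U \<subset> S' \<and> S' \<subset> carrier R"
    then obtain Q where Q: "subring Q R" "?U \<subset> Q" "Q \<subset> carrier R" by blast
    have "T \<subseteq> h ` Q"
    proof
      fix t assume t: "t \<in> T"
      then have "t \<in> h ` carrier R" using T(2) surj by auto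
      then obtain x where "x \<in> carrier R" "t = h x" by (rule imageE)
      then show "t \<in> h ` Q" using t Q(2) by blast
    qed
    moreover obtain x where x: "x \<in> Q" "x \<notin> ?U" using Q(2) by blast
    then have "h x \<in> h ` Q" "h x \<notin> T" using Q(3) by blast+
    moreover have "h ` Q \<subset> carrier S"
    proof
      show "h ` Q \<subseteq> carrier S" using subringE(1)[OF img_is_subring[OF Q(1)]] .
      obtain y where y: "y \<in> carrier R" "y \<notin> Q" using Q(3) by blast
      have "h y \<notin> h ` Q"
      proof
        assume "h y \<in> h ` Q"
        then obtain z where z: "z \<in> Q" "h y = h z" by blast
        have zR: "z \<in> carrier R" using z(1) Q(3) by blast
        have "h (y \<ominus> z) = \<zero>\<^bsub>S\<^esub>" using y zR z(2) by (simp add: a_minus_def S.r_neg)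
        then have "y \<ominus> z \<in> ?U" using y zR subringE(2)[OF T(1)] by simp
        then have "y \<ominus> z \<in> Q" by (rule subsetD[OF psubset_imp_subset[OF Q(2)]])
        then have "(y \<ominus> z) \<oplus> z \<in> Q" by (rule subringE(7)[OF Q(1) _ z(1)])
        moreover have "(y \<ominus> z) \<oplus> z = y" using y zR by (simp add: R.minus_eq R.a_assoc R.l_neg)
        ultimately show False using y(2) by simp
      qed
      then show "h ` Q \<noteq> carrier S" using hom_closed[OF y(1)] by metis
    qed
    ultimately have "T \<subset> h ` Q" "h ` Q \<subset> carrier S" by auto
    then show False using T(3) img_is_subring[OF Q(1)] by auto
  qed
  then show ?thesis unfolding submaximal_def by blast
qed

lemma (in ideal) submaximal_Quot: "submaximal (R Quot I) \<Longrightarrow> submaximal R"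
  by (rule ring_hom_ring.submaximal_vimage[OF rcos_ring_hom_ring])
    (auto simp: FactRing_def A_RCOSETS_def')

lemma (in ring_hom_ring) hom_Units: "x \<in> Units R \<Longrightarrow> h x \<in> Units S"
  unfolding Units_def by auto (metis hom_closed hom_mult hom_one)

text \<open>The domain criterion is applied modulo a prime ideal that omits \<open>a\<close>. Units
  and the subring \<open>Q\<close> pass to the quotient, and a maximal subring pulls back.\<close>

lemma (in cring) submaximal_of_nonnilpotent:
  assumes Q: "subring Q R" and a: "a \<in> Q" "\<And>n::nat. a [^] n \<noteq> \<zero>"
    and units: "\<And>t. t \<in> Q \<Longrightarrow> \<one> \<oplus> a \<otimes> t \<in> Units R"
  shows "submaximal R"
proof -
  have QR: "x \<in> carrier R" if "x \<in> Q" for x using that subringE(1)[OF Q] by blast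
  obtain P where P: "primeideal P R" "a \<notin> P"
    using primeideal_avoiding_powers[OF QR[OF a(1)] a(2)] by blast
  interpret P: primeideal P R by (rule P(1))
  interpret D: domain "R Quot P" by (rule P.quotient_is_domain)
  interpret h: ring_hom_ring R "R Quot P" "(+>) P" by (rule P.rcos_ring_hom_ring)
  have "submaximal (R Quot P)"
  proof (rule D.submaximal_of_quasi_radical[OF h.img_is_subring[OF Q]])
    show "P +> a \<in> (+>) P ` Q" using a(1) by blast
    show "P +> a \<noteq> \<zero>\<^bsub>R Quot P\<^esub>"
    proof
      assume "P +> a = \<zero>\<^bsub>R Quot P\<^esub>"
      moreover have "\<zero>\<^bsub>R Quot P\<^esub> = P" unfolding FactRing_def by simp
      ultimately show False using P(2) P.a_rcos_self[OF QR[OF a(1)]] by metis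
    qed
    fix t assume "t \<in> (+>) P ` Q"
    then obtain s where s: "s \<in> Q" "t = P +> s" by blast
    have "P +> (\<one> \<oplus> a \<otimes> s) = \<one>\<^bsub>R Quot P\<^esub> \<oplus>\<^bsub>R Quot P\<^esub> (P +> a) \<otimes>\<^bsub>R Quot P\<^esub> t"
      using s a(1) QR by simp
    then show "\<one>\<^bsub>R Quot P\<^esub> \<oplus>\<^bsub>R Quot P\<^esub> (P +> a) \<otimes>\<^bsub>R Quot P\<^esub> t \<in> Units (R Quot P)"
      using h.hom_Units[OF units[OF s(1)]] by simp
  qed
  then show ?thesis by (rule P.submaximal_Quot)
qed

section \<open>Countability of fields without maximal subrings\<close>

lemma (in cring) poly_values_eval:
  assumes B: "subring B R" and y: "y \<in> carrier R"
  shows "t \<in> poly_values B y k \<Longrightarrow> \<exists>p. set p \<subseteq> B \<and> length p = k \<and> eval p y = t"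
proof (induction k arbitrary: t)
  case (Suc k)
  obtain t' s where t: "t' \<in> poly_values B y k" "s \<in> B" "t = t' \<oplus> s \<otimes> y [^] k"
    using poly_values_topE[OF B y Suc.prems] by blast
  obtain p where p: "set p \<subseteq> B" "length p = k" "eval p y = t'" using Suc.IH[OF t(1)] by blast
  have "eval (s # p) y = t"
    using p t(3) y base_closed[OF B y t(2)] poly_values_closed[OF B y t(1)] by (simp add: a_comm)
  then show ?case using p t(2) by (intro exI[of _ "s # p"]) simp
qed simp

text \<open>Every element is a root of one of countably many nonzero polynomials, each of which has
  finitely many roots.\<close>

lemma (in domain) countable_carrier_of_algebraic:
  assumes B: "subring B R" "countable B" and alg: "\<And>y. y \<in> carrier R \<Longrightarrow> algebraic_over B y"
  shows "countable (carrier R)"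
proof -
  let ?L = "{p \<in> lists B. p \<in> carrier (poly_ring R)}"
  have "carrier R \<subseteq> (\<Union>p\<in>?L. {x. is_root p x})"
  proof
    fix y assume y: "y \<in> carrier R"
    obtain k c where c: "c \<in> B" "c \<noteq> \<zero>" "c \<otimes> y [^] k \<in> poly_values B y k"
      using alg[OF y] unfolding algebraic_over_def by blast
    obtain p where p: "set p \<subseteq> B" "length p = k" "eval p y = \<ominus> (c \<otimes> y [^] k)"
      using poly_values_eval[OF B(1) y poly_values_minus[OF B(1) y c(3)]] by blast
    \<comment> \<open>Coefficient lists start with the leading term, so \<open>c # p\<close> has the
      nonzero leading coefficient \<open>c\<close> and evaluates to \<open>c y [^] k\<close> minus
      itself.\<close>
    have "eval (c # p) y = \<zero>"
      using p y base_closed[OF B(1) y c(1)] by (simp add: r_neg)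
    moreover have "c # p \<in> carrier (poly_ring R)"
      using c(1,2) p(1) subringE(1)[OF B(1)] unfolding univ_poly_def polynomial_def by auto
    ultimately show "y \<in> (\<Union>p\<in>?L. {x. is_root p x})"
      unfolding is_root_def using y c(1) p(1) by (intro UN_I[of "c # p"]) auto
  qed
  moreover have "countable (\<Union>p\<in>?L. {x. is_root p x})"
  proof (rule countable_UN)
    show "countable ?L" using B(2) by (auto intro: countable_subset[OF _ countable_lists[OF B(2)]])
    show "countable {x. is_root p x}" if "p \<in> ?L" for p
      using that finite_number_of_roots by (auto intro: countable_finite)
  qed
  ultimately show ?thesis by (rule countable_subset)
qed

text \<open>All nonzero elements of a field are units, so one transcendental over the prime subring
  would already give a maximal subring.\<close>

lemma (in field) countable_carrier_of_not_submaximal: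
  assumes "\<not> submaximal R"
  shows "countable (carrier R)"
proof (rule countable_carrier_of_algebraic[OF prime_subring_is_subring])
  show "countable prime_subring" unfolding prime_subring_def by simp
  fix y assume y: "y \<in> carrier R"
  show "algebraic_over prime_subring y"
  proof (cases "y = \<zero>")
    case True
    then have "\<one> \<otimes> y [^] Suc 0 \<in> poly_values prime_subring y (Suc 0)"
      using poly_values_zero[OF prime_subring_is_subring y] by simp
    then show ?thesis
      using subringE(3)[OF prime_subring_is_subring] one_not_zero unfolding algebraic_over_def by blast
  next
    case False
    then show ?thesis
      using transcendental_unit_imp_submaximal[OF _ prime_subring_is_subring] assms y field_Units by blast
  qed
qed

section \<open>Maximal ideals with the same residue field\<close>

lemma (in cring) maximalideal_comaximal:
  assumes "maximalideal N R" "w \<in> carrier R" "w \<notin> N"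
  obtains t n where "t \<in> carrier R" "n \<in> N" "t \<otimes> w \<oplus> n = \<one>"
proof -
  interpret N: maximalideal N R by (rule assms(1))
  interpret I: ideal "PIdl w <+>\<^bsub>R\<^esub> N" R
    using add_ideals[OF cgenideal_ideal[OF assms(2)] N.is_ideal] .
  have z: "\<zero> \<in> PIdl w"
    by (rule additive_subgroup.zero_closed[OF ideal.axioms(1)[OF cgenideal_ideal[OF assms(2)]]])
  have "N \<subseteq> PIdl w <+>\<^bsub>R\<^esub> N"
  proof
    fix n assume n: "n \<in> N"
    then have "\<zero> \<oplus> n \<in> PIdl w <+>\<^bsub>R\<^esub> N" unfolding set_add_def' using z by blast
    then show "n \<in> PIdl w <+>\<^bsub>R\<^esub> N" using N.Icarr[OF n] by simp
  qed
  moreover have "w \<in> PIdl w <+>\<^bsub>R\<^esub> N"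
  proof -
    have "w \<oplus> \<zero> \<in> PIdl w <+>\<^bsub>R\<^esub> N"
      unfolding set_add_def' using N.zero_closed cgenideal_self[OF assms(2)] by blast
    then show ?thesis using assms(2) by simp
  qed
  ultimately have "PIdl w <+>\<^bsub>R\<^esub> N = carrier R"
    using N.I_maximal[OF I.is_ideal] I.a_subset assms(3) by auto
  then have "\<one> \<in> PIdl w <+>\<^bsub>R\<^esub> N" by simp
  then show thesis unfolding set_add_def' cgenideal_def using that by auto
qed

text \<open>When \<open>e\<close> enumerates a residue field by natural numbers, this set of quadruples records the
  isomorphism type of that field.\<close>

definition (in ring) operation_graph :: "('a \<Rightarrow> 'c) \<Rightarrow> ('c \<times> 'c \<times> 'c \<times> 'c) set" where
  "operation_graph e =
     (\<lambda>(x, y). (e x, e y, e (x \<oplus> y), e (x \<otimes> y))) ` (carrier R \<times> carrier R)"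

context cring
begin

lemma operation_graphE:
  assumes "operation_graph e \<subseteq> operation_graph e'" "x \<in> carrier R" "y \<in> carrier R"
  obtains x' y' where "x' \<in> carrier R" "y' \<in> carrier R" "e x = e' x'" "e y = e' y'"
    "e (x \<oplus> y) = e' (x' \<oplus> y')" "e (x \<otimes> y) = e' (x' \<otimes> y')"
proof -
  have "(e x, e y, e (x \<oplus> y), e (x \<otimes> y)) \<in> operation_graph e"
    unfolding operation_graph_def by (rule image_eqI[of _ _ "(x, y)"]) (use assms in auto)
  then have "(e x, e y, e (x \<oplus> y), e (x \<otimes> y)) \<in> operation_graph e'" using assms(1) by blast
  then show thesis unfolding operation_graph_def by (auto intro: that)
qed

text \<open>Chinese remainder theorem: \<open>t'\<close> is chosen with the code under
  \<open>eN\<close> that \<open>t\<close> has under \<open>eM\<close>, and \<open>s\<close> is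
  congruent to \<open>t\<close> modulo \<open>M\<close> and to \<open>t'\<close> modulo
  \<open>N\<close>.\<close>

lemma operation_graph_lift:
  assumes M: "ideal M R" and eM: "\<And>x y. x \<in> carrier R \<Longrightarrow> y \<in> carrier R \<Longrightarrow> eM x = eM y \<longleftrightarrow> x \<ominus> y \<in> M"
    and N: "ideal N R" and eN: "\<And>x y. x \<in> carrier R \<Longrightarrow> y \<in> carrier R \<Longrightarrow> eN x = eN y \<longleftrightarrow> x \<ominus> y \<in> N"
    and sub: "operation_graph eM \<subseteq> operation_graph eN"
    and mn: "m \<in> M" "n \<in> N" "m \<oplus> n = \<one>" and t: "t \<in> carrier R"
  obtains s where "s \<in> carrier R" "eM s = eN s" "s \<ominus> t \<in> M"
proof -
  interpret M: ideal M R by (rule M)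
  interpret N: ideal N R by (rule N)
  obtain t' where t': "t' \<in> carrier R" "eM t = eN t'" using operation_graphE[OF sub t t] by metis
  have R: "m \<in> carrier R" "n \<in> carrier R" using mn M.Icarr N.Icarr by auto
  let ?s = "t \<otimes> n \<oplus> t' \<otimes> m"
  have sR: "?s \<in> carrier R" using R t t' by simp
  have "?s \<ominus> t \<otimes> (m \<oplus> n) = (t' \<ominus> t) \<otimes> m" using R t t'(1) by algebra
  then have s1: "?s \<ominus> t = (t' \<ominus> t) \<otimes> m" unfolding mn(3) using t by simp
  have "?s \<ominus> t' \<otimes> (m \<oplus> n) = (t \<ominus> t') \<otimes> n" using R t t'(1) by algebra
  then have s2: "?s \<ominus> t' = (t \<ominus> t') \<otimes> n" unfolding mn(3) using t' by simp
  have "?s \<ominus> t \<in> M" unfolding s1 using M.I_l_closed[OF mn(1)] t t'(1) by simp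
  moreover have "?s \<ominus> t' \<in> N" unfolding s2 using N.I_l_closed[OF mn(2)] t t'(1) by simp
  ultimately have "eM ?s = eM t" "eN ?s = eN t'" using eM[OF sR t] eN[OF sR t'(1)] by auto
  then have "eM ?s = eN ?s" using t'(2) by simp
  then show thesis using that[OF sR] \<open>?s \<ominus> t \<in> M\<close> by blast
qed

text \<open>Equal graphs identify both residue fields with one field \<open>k\<close>, and
  \<open>S\<close> is the preimage of the diagonal under the surjection of \<open>R\<close> onto
  \<open>k \<times> k\<close>. The diagonal is a maximal subring there; the proof carries this out
  inside \<open>R\<close>.\<close>

lemma submaximal_of_same_residue_field:
  assumes M: "maximalideal M R" and N: "maximalideal N R" and neq: "M \<noteq> N"
    and eM: "\<And>x y. x \<in> carrier R \<Longrightarrow> y \<in> carrier R \<Longrightarrow> eM x = eM y \<longleftrightarrow> x \<ominus> y \<in> M"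
    and eN: "\<And>x y. x \<in> carrier R \<Longrightarrow> y \<in> carrier R \<Longrightarrow> eN x = eN y \<longleftrightarrow> x \<ominus> y \<in> N"
    and graph: "operation_graph eM = operation_graph eN"
  shows "submaximal R"
proof -
  interpret M: maximalideal M R by (rule M)
  interpret N: maximalideal N R by (rule N)
  interpret NP: primeideal N R by (rule maximalideal_prime[OF N])
  have sub: "operation_graph eM \<subseteq> operation_graph eN" "operation_graph eN \<subseteq> operation_graph eM"
    using graph by auto
  have "\<not> M \<subseteq> N"
    using M.I_maximal[OF N.is_ideal] N.I_notcarr N.a_subset neq by auto
  then obtain w0 where w0: "w0 \<in> M" "w0 \<notin> N" by blast
  obtain t0 n where tn: "t0 \<in> carrier R" "n \<in> N" "t0 \<otimes> w0 \<oplus> n = \<one>"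
    using maximalideal_comaximal[OF N M.Icarr[OF w0(1)] w0(2)] by blast
  define m where "m = t0 \<otimes> w0"
  have mn: "m \<in> M" "n \<in> N" "m \<oplus> n = \<one>"
    using tn w0(1) M.I_l_closed unfolding m_def by auto
  have mnR: "m \<in> carrier R" "n \<in> carrier R" using mn M.Icarr N.Icarr by auto
  have nm: "n \<oplus> m = \<one>" using mn(3) mnR a_comm by simp
  define S where "S = {x \<in> carrier R. eM x = eN x}"
  have SR: "x \<in> carrier R" if "x \<in> S" for x using that unfolding S_def by blast
  have liftM: "\<exists>s\<in>S. s \<ominus> t \<in> M" if t: "t \<in> carrier R" for t
    using operation_graph_lift[OF M.is_ideal eM N.is_ideal eN sub(1) mn t] unfolding S_def by blast
  have liftN: "\<exists>s\<in>S. s \<ominus> t \<in> N" if t: "t \<in> carrier R" for t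
  proof -
    obtain s where "s \<in> carrier R" "eN s = eM s" "s \<ominus> t \<in> N"
      using operation_graph_lift[OF N.is_ideal eN M.is_ideal eM sub(2) mn(2,1) nm t] by blast
    then show ?thesis unfolding S_def by (intro bexI[of _ s]) simp_all
  qed
  \<comment> \<open>The graph names no constants. Zero is recovered as the only solution of
    \<open>x + x = x\<close>.\<close>
  have zero: "eM \<zero> = eN \<zero>"
  proof -
    obtain x y where xy: "x \<in> carrier R" "y \<in> carrier R" "eM \<zero> = eN x" "eM \<zero> = eN y"
      "eM (\<zero> \<oplus> \<zero>) = eN (x \<oplus> y)"
      using operation_graphE[OF sub(1) zero_closed zero_closed] by metis
    have "eN (x \<oplus> y) = eN x" using xy by simp
    then have "(x \<oplus> y) \<ominus> x \<in> N" using eN[of "x \<oplus> y" x] xy(1,2) by simp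
    moreover have "(x \<oplus> y) \<ominus> x = y \<ominus> \<zero>" using xy(1,2) by algebra
    ultimately have "eN y = eN \<zero>" using eN[OF xy(2) zero_closed] by simp
    then show ?thesis using xy(4) by simp
  qed
  \<comment> \<open>One is recovered as the nonzero idempotent: \<open>x\<close> and
    \<open>y\<close> have the same code, and primality of \<open>N\<close> leaves only
    \<open>x \<in> N\<close>, which would put \<open>\<one>\<close> into \<open>M\<close>, or
    \<open>y\<close> congruent to \<open>\<one>\<close>.\<close>
  have one: "eM \<one> = eN \<one>"
  proof -
    obtain x y where xy: "x \<in> carrier R" "y \<in> carrier R" "eM \<one> = eN x" "eM \<one> = eN y"
      "eM (\<one> \<otimes> \<one>) = eN (x \<otimes> y)"
      using operation_graphE[OF sub(1) one_closed one_closed] by metis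
    have "eN x = eN (x \<otimes> y)" using xy by simp
    then have "x \<ominus> x \<otimes> y \<in> N" using eN[of x "x \<otimes> y"] xy(1,2) by simp
    moreover have "x \<ominus> x \<otimes> y = x \<otimes> (\<one> \<ominus> y)" using xy(1,2) by algebra
    ultimately consider "x \<in> N" | "\<one> \<ominus> y \<in> N" using NP.I_prime[of x "\<one> \<ominus> y"] xy(1,2) by auto
    then show ?thesis
    proof cases
      case 1
      then have "x \<ominus> \<zero> \<in> N" using xy(1) by (simp add: minus_eq)
      then have "eN x = eN \<zero>" using eN[OF xy(1) zero_closed] by simp
      then have "\<one> \<ominus> \<zero> \<in> M" using xy(3) zero eM[OF one_closed zero_closed] by simp
      then have "\<one> \<in> M" by (simp add: minus_eq)
      then show ?thesis using M.one_imp_carrier M.I_notcarr by simp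
    next
      case 2
      then have "eN \<one> = eN y" using eN[OF one_closed xy(2)] by simp
      then show ?thesis using xy(4) by simp
    qed
  qed
  have MN: "x \<in> S" if x: "x \<in> M" "x \<in> N" for x
  proof -
    have xR: "x \<in> carrier R" using M.Icarr x(1) by blast
    have "eM x = eM \<zero>" "eN x = eN \<zero>"
      using eM[OF xR zero_closed] eN[OF xR zero_closed] x xR by (auto simp: minus_eq)
    then show ?thesis unfolding S_def using zero xR by simp
  qed
  have S_op: "eM (x \<oplus> y) = eN (x \<oplus> y) \<and> eM (x \<otimes> y) = eN (x \<otimes> y)" if xy: "x \<in> S" "y \<in> S" for x y
  proof -
    obtain x' y' where *: "x' \<in> carrier R" "y' \<in> carrier R" "eM x = eN x'" "eM y = eN y'"
      "eM (x \<oplus> y) = eN (x' \<oplus> y')" "eM (x \<otimes> y) = eN (x' \<otimes> y')"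
      using operation_graphE[OF sub(1) SR[OF xy(1)] SR[OF xy(2)]] by metis
    note R = SR[OF xy(1)] SR[OF xy(2)] *(1,2)
    have d: "x' \<ominus> x \<in> N" "y' \<ominus> y \<in> N"
      using xy *(3,4) eN[OF R(3,1)] eN[OF R(4,2)] unfolding S_def by auto
    have "(x' \<oplus> y') \<ominus> (x \<oplus> y) = (x' \<ominus> x) \<oplus> (y' \<ominus> y)" using R by algebra
    then have 1: "(x' \<oplus> y') \<ominus> (x \<oplus> y) \<in> N" using N.a_closed[OF d] by simp
    have "(x' \<otimes> y') \<ominus> (x \<otimes> y) = x' \<otimes> (y' \<ominus> y) \<oplus> y \<otimes> (x' \<ominus> x)" using R by algebra
    then have 2: "(x' \<otimes> y') \<ominus> (x \<otimes> y) \<in> N"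
      using N.a_closed[OF N.I_l_closed[OF d(2) R(3)] N.I_l_closed[OF d(1) R(2)]] by simp
    show ?thesis using 1 2 * R eN by simp
  qed
  have S: "subring S R"
  proof (rule subringI)
    show "S \<subseteq> carrier R" unfolding S_def by blast
    show "\<one> \<in> S" unfolding S_def using one by simp
    show "x \<otimes> y \<in> S" "x \<oplus> y \<in> S" if "x \<in> S" "y \<in> S" for x y
      using S_op[OF that] SR[OF that(1)] SR[OF that(2)] unfolding S_def by auto
    fix x assume x: "x \<in> S"
    have xR: "x \<in> carrier R" using SR[OF x] .
    obtain x' y' where *: "x' \<in> carrier R" "y' \<in> carrier R" "eM x = eN x'" "eM (\<ominus> x) = eN y'"
      "eM (x \<oplus> \<ominus> x) = eN (x' \<oplus> y')"
      using operation_graphE[OF sub(1) xR a_inv_closed[OF xR]] by metis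
    have "eN (x' \<oplus> y') = eN \<zero>" using *(5) zero xR by (simp add: r_neg)
    then have 1: "(x' \<oplus> y') \<ominus> \<zero> \<in> N" using eN[of "x' \<oplus> y'" \<zero>] * by simp
    have "eN x = eN x'" using x *(3) unfolding S_def by simp
    then have 2: "x \<ominus> x' \<in> N" using eN[OF xR *(1)] by simp
    have "y' \<ominus> (\<ominus> x) = ((x' \<oplus> y') \<ominus> \<zero>) \<oplus> (x \<ominus> x')" using xR * by algebra
    then have "y' \<ominus> (\<ominus> x) \<in> N" using N.a_closed[OF 1 2] by simp
    then have "eN y' = eN (\<ominus> x)" using eN[OF *(2) a_inv_closed[OF xR]] by simp
    then show "\<ominus> x \<in> S" unfolding S_def using *(4) xR by simp
  qed
  have mS: "m \<notin> S"
  proof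
    assume "m \<in> S"
    moreover have "eM m = eM \<zero>" using eM[OF mnR(1) zero_closed] mn(1) mnR(1) by (simp add: minus_eq)
    ultimately have "eN m = eN \<zero>" using zero unfolding S_def by simp
    then have "m \<in> N" using eN[OF mnR(1) zero_closed] mnR(1) by (simp add: minus_eq)
    then have "\<one> \<in> N" using N.a_closed[OF _ mn(2)] mn(3) by metis
    then show False using N.one_imp_carrier N.I_notcarr by simp
  qed
  have max: "carrier R \<subseteq> Q" if Q: "subring Q R" "S \<subset> Q" for Q
  proof
    fix x assume x: "x \<in> carrier R"
    note QR = subsetD[OF subringE(1)[OF Q(1)]]
    have SQ: "y \<in> Q" if "y \<in> S" for y using Q(2) that by blast
    obtain z where z: "z \<in> Q" "z \<notin> S" using Q(2) by blast
    \<comment> \<open>An element \<open>z\<close> of \<open>Q\<close> outside \<open>S\<close> is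
      moved into \<open>M\<close> by subtracting it from an element of \<open>S\<close>. The
      difference \<open>?w\<close> avoids \<open>N\<close>, since otherwise \<open>z\<close> would
      have equal codes.\<close>
    obtain s where s: "s \<in> S" "s \<ominus> z \<in> M" using liftM[OF QR[OF z(1)]] by blast
    let ?w = "s \<ominus> z"
    have R: "s \<in> carrier R" "z \<in> carrier R" "?w \<in> carrier R" using SR[OF s(1)] QR[OF z(1)] by auto
    have wQ: "?w \<in> Q" by (rule subring_minus[OF Q(1) SQ[OF s(1)] z(1)])
    have "?w \<notin> N"
    proof
      assume "?w \<in> N"
      then have "eN s = eN z" "eM s = eM z" using eM eN R s(2) by auto
      then show False using z(2) s(1) R(2) unfolding S_def by simp
    qed
    then obtain t n' where t: "t \<in> carrier R" "n' \<in> N" "t \<otimes> ?w \<oplus> n' = \<one>"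
      using maximalideal_comaximal[OF N R(3)] by blast
    have nR: "n' \<in> carrier R" using N.Icarr[OF t(2)] .
    \<comment> \<open>Replacing \<open>r\<close> by an element of \<open>S\<close> congruent to it
      modulo \<open>N\<close> changes \<open>r ?w\<close> only by an element of
      \<open>M \<inter> N\<close>, which is contained in \<open>S\<close>.\<close>
    have wmult: "r \<otimes> ?w \<in> Q" if r: "r \<in> carrier R" for r
    proof -
      obtain s' where s': "s' \<in> S" "s' \<ominus> r \<in> N" using liftN[OF r] by blast
      note s'R = SR[OF s'(1)]
      have "(s' \<ominus> r) \<otimes> ?w \<in> M" using M.I_l_closed[OF s(2)] s'R r by simp
      moreover have "(s' \<ominus> r) \<otimes> ?w \<in> N" by (rule N.I_r_closed[OF s'(2) R(3)])
      ultimately have 1: "(s' \<ominus> r) \<otimes> ?w \<in> Q" by (intro SQ MN)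
      have "s' \<otimes> ?w \<ominus> (s' \<ominus> r) \<otimes> ?w \<in> Q"
        by (rule subring_minus[OF Q(1) subringE(6)[OF Q(1) SQ[OF s'(1)] wQ] 1])
      moreover have "s' \<otimes> ?w \<ominus> (s' \<ominus> r) \<otimes> ?w = r \<otimes> ?w" using s'R r R(1,2) by algebra
      ultimately show ?thesis by simp
    qed
    \<comment> \<open>Multiplying \<open>t ?w + n' = 1\<close> by \<open>s1 - x\<close> gives a
      multiple of \<open>?w\<close> plus an element of \<open>M \<inter> N\<close>, both of which
      belong to \<open>Q\<close>.\<close>
    obtain s1 where s1: "s1 \<in> S" "s1 \<ominus> x \<in> M" using liftM[OF x] by blast
    note s1R = SR[OF s1(1)]
    have dR: "s1 \<ominus> x \<in> carrier R" using s1R x by simp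
    have "n' \<otimes> (s1 \<ominus> x) \<in> S"
      by (rule MN[OF M.I_l_closed[OF s1(2) nR] N.I_r_closed[OF t(2) dR]])
    then have "((s1 \<ominus> x) \<otimes> t) \<otimes> ?w \<oplus> n' \<otimes> (s1 \<ominus> x) \<in> Q"
      using subringE(7)[OF Q(1) wmult SQ] dR t(1) by simp
    moreover have "((s1 \<ominus> x) \<otimes> t) \<otimes> ?w \<oplus> n' \<otimes> (s1 \<ominus> x) = (s1 \<ominus> x) \<otimes> (t \<otimes> ?w \<oplus> n')"
      using dR t(1) R(3) nR by (simp add: r_distr m_assoc m_comm[of n'])
    ultimately have "s1 \<ominus> x \<in> Q" using t(3) dR by simp
    then have "s1 \<ominus> (s1 \<ominus> x) \<in> Q" by (rule subring_minus[OF Q(1) SQ[OF s1(1)]])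
    moreover have "s1 \<ominus> (s1 \<ominus> x) = x" using s1R x by algebra
    ultimately show "x \<in> Q" by simp
  qed
  have "maximal_subring S R"
    unfolding maximal_subring_def using S mS mnR(1) max SR by blast
  then show ?thesis unfolding submaximal_def by blast
qed

text \<open>A maximal subring of the residue field would pull back to \<open>R\<close>, so the
  residue field is countable and its cosets can be numbered.\<close>

lemma residue_field_enumeration:
  assumes M: "maximalideal M R" and "\<not> submaximal R"
  shows "\<exists>e::'a \<Rightarrow> nat. \<forall>x\<in>carrier R. \<forall>y\<in>carrier R. e x = e y \<longleftrightarrow> x \<ominus> y \<in> M"
proof -
  interpret M: maximalideal M R by (rule M)
  interpret F: field "R Quot M" by (rule M.quotient_is_field[OF is_cring])
  have "countable (carrier (R Quot M))"
    using F.countable_carrier_of_not_submaximal M.submaximal_Quot assms(2) by blast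
  then have inj: "inj_on (to_nat_on (carrier (R Quot M))) (carrier (R Quot M))"
    by (rule inj_on_to_nat_on)
  have mem: "M +> x \<in> carrier (R Quot M)" if "x \<in> carrier R" for x
    using ring_hom_closed[OF M.rcos_ring_hom that] .
  show ?thesis
    by (intro exI[of _ "\<lambda>x. to_nat_on (carrier (R Quot M)) (M +> x)"] ballI)
      (simp add: inj_on_eq_iff[OF inj mem mem] quotient_eq_iff_same_a_r_cos[OF M.is_ideal])
qed

end

section \<open>The radical case and the cardinality bound\<close>

lemma submaximal_of_reduced_subring:
  fixes R :: "('a, 'm) ring_scheme" and T :: "('b, 'n) ring_scheme"
  assumes "cring R" "reduced_ring R" "cring T" "h \<in> ring_hom R T" "inj_on h (carrier R)"
    and big: "jacobson_radical R \<noteq> {\<zero>\<^bsub>R\<^esub>} \<or> Pow (Pow (UNIV :: nat set)) \<prec> carrier R"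
  shows "submaximal T"
proof (rule ccontr)
  assume ns: "\<not> submaximal T"
  interpret R: cring R by fact
  interpret T: cring T by fact
  interpret h: ring_hom_ring R T h
    by (rule ring_hom_ringI2) (use assms R.ring_axioms T.ring_axioms in auto)
  \<comment> \<open>Reducedness of \<open>R\<close> and injectivity of \<open>h\<close> suffice
    here; \<open>T\<close> itself may have nilpotent elements.\<close>
  have nonnilp: "h x [^]\<^bsub>T\<^esub> n \<noteq> \<zero>\<^bsub>T\<^esub>"
    if x: "x \<in> carrier R" "x \<noteq> \<zero>\<^bsub>R\<^esub>" for x and n :: nat
  proof
    assume "h x [^]\<^bsub>T\<^esub> n = \<zero>\<^bsub>T\<^esub>"
    moreover have "h (x [^]\<^bsub>R\<^esub> n) = h x [^]\<^bsub>T\<^esub> n" using x(1) by (induction n) auto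
    ultimately have "h (x [^]\<^bsub>R\<^esub> n) = h \<zero>\<^bsub>R\<^esub>" by simp
    then have "x [^]\<^bsub>R\<^esub> n = \<zero>\<^bsub>R\<^esub>"
      by (rule inj_onD[OF assms(5) _ R.nat_pow_closed[OF x(1)] R.zero_closed])
    then show False using assms(2) x unfolding reduced_ring_def by blast
  qed
  from big show False
  proof
    assume J: "jacobson_radical R \<noteq> {\<zero>\<^bsub>R\<^esub>}"
    have "\<zero>\<^bsub>R\<^esub> \<in> jacobson_radical R"
      unfolding jacobson_radical_def
      by (auto intro: additive_subgroup.zero_closed ideal.axioms(1) maximalideal.axioms(1))
    then obtain a where a: "a \<in> jacobson_radical R" "a \<noteq> \<zero>\<^bsub>R\<^esub>" using J by blast
    have aR: "a \<in> carrier R" using a(1) unfolding jacobson_radical_def by blast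
    have "submaximal T"
    proof (rule T.submaximal_of_nonnilpotent[OF h.img_is_subring[OF R.carrier_is_subring]])
      show "h a \<in> h ` carrier R" using aR by blast
      show "h a [^]\<^bsub>T\<^esub> n \<noteq> \<zero>\<^bsub>T\<^esub>" for n :: nat by (rule nonnilp[OF aR a(2)])
      fix t assume "t \<in> h ` carrier R"
      then obtain r where r: "r \<in> carrier R" "t = h r" by blast
      show "\<one>\<^bsub>T\<^esub> \<oplus>\<^bsub>T\<^esub> h a \<otimes>\<^bsub>T\<^esub> t \<in> Units T"
        using h.hom_Units[OF R.jacobson_radical_units[OF a(1) r(1)]] aR r by simp
    qed
    then show False using ns by blast
  next
    assume card: "Pow (Pow (UNIV :: nat set)) \<prec> carrier R"
    have "\<forall>M. \<exists>e::'b \<Rightarrow> nat. maximalideal M T \<longrightarrow>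
        (\<forall>x\<in>carrier T. \<forall>y\<in>carrier T. e x = e y \<longleftrightarrow> x \<ominus>\<^bsub>T\<^esub> y \<in> M)"
      using T.residue_field_enumeration[OF _ ns] by blast
    then obtain e :: "'b set \<Rightarrow> 'b \<Rightarrow> nat" where e: "\<And>M x y. maximalideal M T \<Longrightarrow>
        x \<in> carrier T \<Longrightarrow> y \<in> carrier T \<Longrightarrow> e M x = e M y \<longleftrightarrow> x \<ominus>\<^bsub>T\<^esub> y \<in> M"
      by metis
    \<comment> \<open>A maximal ideal is determined by the graph of its enumeration, because two
      distinct ones with the same graph would make \<open>T\<close> submaximal.\<close>
    have graph_inj: "M = N" if "maximalideal M T" "maximalideal N T"
        "T.operation_graph (e M) = T.operation_graph (e N)" for M N
      using T.submaximal_of_same_residue_field[OF that(1,2) _ e[OF that(1)] e[OF that(2)] that(3)] ns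
      by blast
    \<comment> \<open>The key of \<open>r\<close> at \<open>M\<close> records both the ideal,
      through its graph, and the residue of \<open>h r\<close>; the two summands keep these data
      apart. Coded by \<open>to_nat\<close> it is a set of naturals, so \<open>\<Phi> r\<close> is a
      set of such sets.\<close>
    define key where "key M r = Inl ` T.operation_graph (e M) \<union> {Inr (e M (h r))}" for M r
    define \<Phi> where "\<Phi> r = (\<lambda>M. to_nat ` key M r) ` {M. maximalideal M T}" for r
    have "inj_on \<Phi> (carrier R)"
    proof (rule inj_onI, rule ccontr)
      fix r s assume rs: "r \<in> carrier R" "s \<in> carrier R" "\<Phi> r = \<Phi> s" "r \<noteq> s"
      let ?d = "r \<ominus>\<^bsub>R\<^esub> s"
      have d: "?d \<in> carrier R" "?d \<noteq> \<zero>\<^bsub>R\<^esub>" using rs by auto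
      have hd: "h ?d = h r \<ominus>\<^bsub>T\<^esub> h s" using rs(1,2) by (simp add: a_minus_def)
      \<comment> \<open>The image of a nonzero element of \<open>R\<close> is not nilpotent, so in
        the radical of \<open>T\<close> it would make \<open>T\<close> submaximal. Hence some
        maximal ideal of \<open>T\<close> separates \<open>h r\<close> from
        \<open>h s\<close>.\<close>
      have "h ?d \<notin> jacobson_radical T"
      proof
        assume J: "h ?d \<in> jacobson_radical T"
        have "submaximal T"
          by (rule T.submaximal_of_nonnilpotent[OF T.carrier_is_subring _ nonnilp[OF d]
                T.jacobson_radical_units[OF J]]) (use d(1) in auto)
        then show False using ns by blast
      qed
      then obtain M where M: "maximalideal M T" "h r \<ominus>\<^bsub>T\<^esub> h s \<notin> M"
        unfolding jacobson_radical_def hd using rs(1,2) by auto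
      have "to_nat ` key M r \<in> \<Phi> r" unfolding \<Phi>_def by (rule imageI) (use M(1) in simp)
      then have "to_nat ` key M r \<in> \<Phi> s" unfolding rs(3) .
      then obtain N where N: "maximalideal N T" "to_nat ` key M r = to_nat ` key N s"
        unfolding \<Phi>_def by (auto elim!: imageE)
      have eq: "key M r = key N s"
        using N(2) by (simp only: inj_image_eq_iff[OF inj_to_nat])
      have "T.operation_graph (e M) = T.operation_graph (e N)"
        using arg_cong[OF eq, of "\<lambda>A. Inl -` A"] unfolding key_def by (auto simp: vimage_def)
      moreover have "e M (h r) = e N (h s)"
        using arg_cong[OF eq, of "\<lambda>A. Inr -` A"] unfolding key_def by (auto simp: vimage_def)
      ultimately have "e M (h r) = e M (h s)" using graph_inj[OF M(1) N(1)] by simp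
      then show False using e[OF M(1)] M(2) rs(1,2) by simp
    qed
    then have "carrier R \<lesssim> Pow (Pow (UNIV :: nat set))"
      unfolding lepoll_def by blast
    then show False using card lepoll_antisym unfolding lesspoll_def by blast
  qed
qed

theorem corollary1p25:
  fixes R :: "('a, 'm) ring_scheme"
  assumes "nonzero_cring R"
    and "reduced_ring R"
    and "jacobson_radical R \<noteq> {\<zero>\<^bsub>R\<^esub>} \<or> Pow (Pow (UNIV :: nat set)) \<prec> carrier R"
  shows "submaximal R \<and>
    (\<forall>(T :: ('b, 'n) ring_scheme) h.
       nonzero_cring T \<and> h \<in> ring_hom R T \<and> inj_on h (carrier R) \<longrightarrow> submaximal T)"
proof (intro conjI allI impI)
  have R: "cring R" using assms(1) unfolding nonzero_cring_def by blast
  \<comment> \<open>Submaximality of \<open>R\<close> itself is the case of the identity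
    embedding.\<close>
  have "(\<lambda>x. x) \<in> ring_hom R R" by (rule ring_hom_memI) auto
  then show "submaximal R"
    using submaximal_of_reduced_subring[OF R assms(2) R _ _ assms(3), of "\<lambda>x. x"] by simp
  fix T :: "('b, 'n) ring_scheme" and h
  assume "nonzero_cring T \<and> h \<in> ring_hom R T \<and> inj_on h (carrier R)"
  then show "submaximal T"
    using submaximal_of_reduced_subring[OF R assms(2) _ _ _ assms(3)] unfolding nonzero_cring_def by blast
qed

end
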